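(* Let $p$ be an odd prime, $\alpha\geqslant1$, and $X\subseteq\mathbb{Z}_{p^\alpha}\setminus\{0\}$, $Y\subseteq\mathbb{Z}_{p^\alpha}$ with $0\in Y$. Then $Dih(p^\alpha,X,Y)$ is a (genuine) directed strongly regular graph with $X\subset Y$ and $Y\setminus X$ a union of some $\mathbb{Z}_{p^\alpha}^\ast$-orbits if and only if $Y=\psi_{\gamma}^{-1}(H)$ and either $X=Y\setminus\{0\}$ or $X=Y\setminus p^\gamma\mathbb{Z}_{p^\alpha}$, for some $1\leqslant\gamma\leqslant\alpha$ and some subset $H\subseteq\mathbb{Z}_{p^\gamma}$ with $H\uplus(-H)=\mathbb{Z}_{p^\gamma}\uplus\{0\}$ (as multisets).
   Context: $D_n=\langle x,a\mid x^n=1,\ a^2=1,\ ax=x^{-1}a\rangle$; for $X,Y\subseteq\mathbb{Z}_n$ with $0\notin X$, $Dih(n,X,Y)$ is the Cayley digraph on $D_n$ with connection set $\{x^i:i\in X\}\cup\{x^ja:j\in Y\}$ (arc $g\to h$ iff $g^{-1}h$ lies in it). A DSRG with parameters $(n,k,\mu,\lambda,t)$: adjacency matrix $A$ with $AJ=JA=kJ$, $A^2=tI+\lambda A+\mu(J-I-A)$; DSRGs are required to be genuine ($0<t<k$). The unit group $\mathbb{Z}_{p^\alpha}^\ast$ acts on $\mathbb{Z}_{p^\alpha}$ by multiplication; its orbits are the sets of elements of a given additive order. $\psi_\gamma:\mathbb{Z}_{p^\alpha}\to\mathbb{Z}_{p^\gamma}$ is reduction mod $p^\gamma$; $p^\gamma\mathbb{Z}_{p^\alpha}$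 is the subgroup of multiples of $p^\gamma$; $\uplus$ is multiset union. *)

theory Defs
  imports
    "HOL-Algebra.Group_Action"
    "HOL-Number_Theory.Residues"
    "HOL-Library.Multiset"
    "Graph_Theory.Pair_Digraph"
begin

(* The pair (i, s) stands for x^i a^s, with 0 <= i < n and s = True iff the factor a is present.
   The relation a x = x^{-1} a gives x^i a x^j a^t = x^{i - j} a^{1 + t}. *)
definition dihedral_group :: "nat \<Rightarrow> (int \<times> bool) monoid" where
  "dihedral_group n =
    \<lparr>carrier = {0..<int n} \<times> UNIV,
     monoid.mult = (\<lambda>(i, s) (j, t). ((if s then i - j else i + j) mod int n, s \<noteq> t)),
     one = (0, False)\<rparr>"

definition dih_x :: "nat \<Rightarrow> int \<times> bool" where
  "dih_x n = (1 mod int n, False)"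

definition dih_a :: "int \<times> bool" where
  "dih_a = (0, True)"

definition cayley_digraph :: "('a, 'b) monoid_scheme \<Rightarrow> 'a set \<Rightarrow> 'a pair_pre_digraph" where
  "cayley_digraph G S =
    \<lparr>pverts = carrier G,
     parcs = {(g, h). g \<in> carrier G \<and> h \<in> carrier G \<and> inv\<^bsub>G\<^esub> g \<otimes>\<^bsub>G\<^esub> h \<in> S}\<rparr>"

definition Dih :: "nat \<Rightarrow> int set \<Rightarrow> int set \<Rightarrow> (int \<times> bool) pair_pre_digraph" where
  "Dih n X Y = (let D = dihedral_group n in
     cayley_digraph D
       ({dih_x n [^]\<^bsub>D\<^esub> i | i. i \<in> X} \<union> {dih_x n [^]\<^bsub>D\<^esub> j \<otimes>\<^bsub>D\<^esub> dih_a | j. j \<in> Y}))"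

(* Square matrices whose rows and columns are indexed by a finite set V are functions of two
   arguments, of which only the values on V matter. *)
definition mat_prod :: "'v set \<Rightarrow> ('v \<Rightarrow> 'v \<Rightarrow> int) \<Rightarrow> ('v \<Rightarrow> 'v \<Rightarrow> int) \<Rightarrow> 'v \<Rightarrow> 'v \<Rightarrow> int" where
  "mat_prod V A B = (\<lambda>u v. \<Sum>w\<in>V. A u w * B w v)"

definition mat_I :: "'v \<Rightarrow> 'v \<Rightarrow> int" where
  "mat_I = (\<lambda>u v. if u = v then 1 else 0)"

definition mat_J :: "'v \<Rightarrow> 'v \<Rightarrow> int" where
  "mat_J = (\<lambda>u v. 1)"

definition adjacency_matrix :: "'v pair_pre_digraph \<Rightarrow> 'v \<Rightarrow> 'v \<Rightarrow> int" where
  "adjacency_matrix G = (\<lambda>u v. if (u, v) \<in> parcs G then 1 else 0)"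

(* Parameters in the order (n, k, mu, lambda, t); l is lambda.  Genuineness is 0 < t < k. *)
definition dsrg :: "'v pair_pre_digraph \<Rightarrow> nat \<Rightarrow> nat \<Rightarrow> nat \<Rightarrow> nat \<Rightarrow> nat \<Rightarrow> bool" where
  "dsrg G n k \<mu> l t \<longleftrightarrow>
    pair_digraph G \<and> card (pverts G) = n \<and>
    (let V = pverts G; A = adjacency_matrix G in
      (\<forall>u\<in>V. \<forall>v\<in>V.
        mat_prod V A mat_J u v = int k * mat_J u v \<and>
        mat_prod V mat_J A u v = int k * mat_J u v \<and>
        mat_prod V A A u v =
          int t * mat_I u v + int l * A u v + int \<mu> * (mat_J u v - mat_I u v - A u v))) \<and>
    0 < t \<and> t < k"

definition is_dsrg :: "'v pair_pre_digraph \<Rightarrow> bool" where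
  "is_dsrg G \<longleftrightarrow> (\<exists>n k \<mu> l t. dsrg G n k \<mu> l t)"

definition unit_orbits :: "int \<Rightarrow> int set set" where
  "unit_orbits m = orbits (units_of (residue_ring m)) (carrier (residue_ring m))
     (\<lambda>u z. u \<otimes>\<^bsub>residue_ring m\<^esub> z)"

definition psi :: "nat \<Rightarrow> nat \<Rightarrow> int \<Rightarrow> int" where
  "psi p \<gamma> z = z mod int p ^ \<gamma>"

definition multiples_subgroup :: "int \<Rightarrow> int \<Rightarrow> int set" where
  "multiples_subgroup d m = {(d * z) mod m | z. z \<in> carrier (residue_ring m)}"

lemma dihedral_group_is_group:
  assumes "n > 0"
  shows "group (dihedral_group n)"
proof (rule groupI)
  fix g h k
  assume "g \<in> carrier (dihedral_group n)" "h \<in> carrier (dihedral_group n)"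
    "k \<in> carrier (dihedral_group n)"
  then show "g \<otimes>\<^bsub>dihedral_group n\<^esub> h \<otimes>\<^bsub>dihedral_group n\<^esub> k =
      g \<otimes>\<^bsub>dihedral_group n\<^esub> (h \<otimes>\<^bsub>dihedral_group n\<^esub> k)"
    by (auto simp: dihedral_group_def mod_simps algebra_simps)
next
  fix g assume g: "g \<in> carrier (dihedral_group n)"
  obtain i s where [simp]: "g = (i, s)" by force
  show "\<exists>h\<in>carrier (dihedral_group n). h \<otimes>\<^bsub>dihedral_group n\<^esub> g = \<one>\<^bsub>dihedral_group n\<^esub>"
    using g assms
    by (intro bexI[of _ "(if s then i else (- i) mod int n, s)"])
       (auto simp: dihedral_group_def mod_simps)
qed (use assms in \<open>auto simp: dihedral_group_def\<close>)

lemma dih_x_pow: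
  assumes "n > 0"
  shows "dih_x n [^]\<^bsub>dihedral_group n\<^esub> (i::int) = (i mod int n, False)"
proof -
  interpret group "dihedral_group n" by (rule dihedral_group_is_group[OF assms])
  have nat: "dih_x n [^]\<^bsub>dihedral_group n\<^esub> (k::nat) = (int k mod int n, False)" for k
    by (induction k) (auto simp: dihedral_group_def dih_x_def mod_simps algebra_simps)
  have inv: "inv\<^bsub>dihedral_group n\<^esub> (j mod int n, False) = ((- j) mod int n, False)" for j
    by (rule inv_equality) (use assms in \<open>auto simp: dihedral_group_def mod_simps\<close>)
  have x: "dih_x n \<in> carrier (dihedral_group n)"
    using assms by (simp add: dihedral_group_def dih_x_def)
  show ?thesis
    using nat by (cases i rule: int_cases2) (auto simp: int_pow_neg[OF x] int_pow_int inv)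
qed

lemma dihedral_group_relations:
  assumes "n > 0"
  shows "dih_x n [^]\<^bsub>dihedral_group n\<^esub> n = \<one>\<^bsub>dihedral_group n\<^esub>"
    and "dih_a [^]\<^bsub>dihedral_group n\<^esub> (2::nat) = \<one>\<^bsub>dihedral_group n\<^esub>"
    and "dih_a \<otimes>\<^bsub>dihedral_group n\<^esub> dih_x n =
      inv\<^bsub>dihedral_group n\<^esub> (dih_x n) \<otimes>\<^bsub>dihedral_group n\<^esub> dih_a"
    and "order (dihedral_group n) = 2 * n"
    and "carrier (dihedral_group n) =
      {dih_x n [^]\<^bsub>dihedral_group n\<^esub> i | i. i \<in> {0..<int n}} \<union>
      {dih_x n [^]\<^bsub>dihedral_group n\<^esub> i \<otimes>\<^bsub>dihedral_group n\<^esub> dih_a | i. i \<in> {0..<int n}}"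
proof -
  interpret group "dihedral_group n" by (rule dihedral_group_is_group[OF assms])
  show "dih_x n [^]\<^bsub>dihedral_group n\<^esub> n = \<one>\<^bsub>dihedral_group n\<^esub>"
    using dih_x_pow[OF assms, of "int n"] by (simp add: int_pow_int dihedral_group_def)
  show "dih_a [^]\<^bsub>dihedral_group n\<^esub> (2::nat) = \<one>\<^bsub>dihedral_group n\<^esub>"
    using assms by (simp add: numeral_2_eq_2 dihedral_group_def dih_a_def)
  have inv: "inv\<^bsub>dihedral_group n\<^esub> (dih_x n) = ((- 1) mod int n, False)"
    by (rule inv_equality) (use assms in \<open>auto simp: dihedral_group_def dih_x_def mod_simps\<close>)
  show "dih_a \<otimes>\<^bsub>dihedral_group n\<^esub> dih_x n =
      inv\<^bsub>dihedral_group n\<^esub> (dih_x n) \<otimes>\<^bsub>dihedral_group n\<^esub> dih_a"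
    unfolding inv by (simp add: dihedral_group_def dih_a_def dih_x_def mod_simps)
  show "order (dihedral_group n) = 2 * n"
    by (simp add: order_def dihedral_group_def card_cartesian_product)
  show "carrier (dihedral_group n) =
      {dih_x n [^]\<^bsub>dihedral_group n\<^esub> i | i. i \<in> {0..<int n}} \<union>
      {dih_x n [^]\<^bsub>dihedral_group n\<^esub> i \<otimes>\<^bsub>dihedral_group n\<^esub> dih_a | i. i \<in> {0..<int n}}"
    (is "?C = ?R \<union> ?S")
  proof -
    have mod_id: "i mod int n = i" if "i \<in> {0..<int n}" for i
      using that by simp
    have "?R = (\<lambda>i. (i mod int n, False)) ` {0..<int n}"
      unfolding dih_x_pow[OF assms] by blast
    also have "\<dots> = (\<lambda>i. (i, False)) ` {0..<int n}"
      by (rule image_cong) (simp_all add: mod_id)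
    finally have R: "?R = {0..<int n} \<times> {False}" by auto
    have "?S = (\<lambda>i. (i mod int n, True)) ` {0..<int n}"
      unfolding dih_x_pow[OF assms] setcompr_eq_image
      by (rule image_cong) (auto simp: dihedral_group_def dih_a_def)
    also have "\<dots> = (\<lambda>i. (i, True)) ` {0..<int n}"
      by (rule image_cong) (simp_all add: mod_id)
    finally have S: "?S = {0..<int n} \<times> {True}" by auto
    show ?thesis
      unfolding R S by (auto simp: dihedral_group_def)
  qed
qed

end

theory Submission
  imports Defs "HOL-Computational_Algebra.Polynomial"
begin

text \<open>
  Identify \<open>X\<close>, \<open>Y\<close> with their indicator functions, write \<open>*\<close> for cyclic convolution,
  \<open>f\<^sup>-(x) = f(- x)\<close>, and put \<open>E = Y - X\<close>, \<open>W = Y + Y\<^sup>-\<close>, \<open>c = \<lambda> - \<mu>\<close>. The digraph is a DSRG iff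
  \<open>X * X + Y * Y\<^sup>- = (t - \<mu>) \<delta> + c X + \<mu>\<close> and \<open>Y * (X + X\<^sup>-) = c Y + \<mu>\<close>, and it is genuine iff moreover
  \<open>X\<close> is not symmetric. As \<open>E\<close> is symmetric, the two equations give \<open>E * E = (t - \<mu>) \<delta> - c E\<close>, so \<open>E\<close>
  is closed under addition, that is, a subgroup; they also give \<open>Y * W = r Y + \<mu>\<close> for some \<open>r\<close>, hence
  \<open>W * W = r W + 2 \<mu>\<close>.

  By the equality case of Cauchy-Schwarz the points where \<open>W = 2\<close> are exactly the periods of \<open>W\<close>, and
  they form a subgroup \<open>p\<^bsup>\<gamma>\<^esup> \<int>\<close>. After passing to \<open>\<int> / p\<^bsup>\<gamma>\<^esup>\<close>, computing the \<open>p\<close>-th convolution power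
  of \<open>W\<close> modulo \<open>p\<close> by the quadratic relation and by Frobenius shows that \<open>W\<close> is constant on the units;
  counting then forces \<open>W = 1 + \<delta>\<close> there.
\<close>

section \<open>Periodic functions on the integers\<close>

text \<open>A function on the integers modulo \<open>m\<close> is represented by an
  \<open>m\<close>-periodic function on all integers. Arguments such as \<open>x - h\<close> then
  need no reduction, and factoring through a quotient just means having a smaller period.\<close>

definition is_period :: "int \<Rightarrow> (int \<Rightarrow> 'a) \<Rightarrow> bool" where
  "is_period m f \<longleftrightarrow> (\<forall>x. f (x + m) = f x)"

lemma is_periodD: "is_period m f \<Longrightarrow> f (x + m) = f x"
  by (simp add: is_period_def)

lemma is_period_minus: "is_period m f \<Longrightarrow> is_period (- m) f"
  unfolding is_period_def by (metis diff_add_cancel add_uminus_conv_diff)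

lemma is_period_add: "is_period a f \<Longrightarrow> is_period b f \<Longrightarrow> is_period (a + b) f"
  unfolding is_period_def by (metis add.assoc)

lemma is_period_diff: "is_period a f \<Longrightarrow> is_period b f \<Longrightarrow> is_period (a - b) f"
  using is_period_add[of a f "- b"] is_period_minus[of b f] by simp

lemma is_period_mult: "is_period m f \<Longrightarrow> is_period (m * k) f"
proof (induction k rule: int_induct[where k = 0])
  case base
  then show ?case by (simp add: is_period_def)
next
  case (step1 i)
  then show ?case using is_period_add[of "m * i" f m] by (simp add: algebra_simps)
next
  case (step2 i)
  then show ?case using is_period_diff[of "m * i" f m] by (simp add: algebra_simps)
qed

lemma is_period_dvd: "is_period m f \<Longrightarrow> m dvd k \<Longrightarrow> is_period k f"
  by (auto simp: is_period_mult)

lemma is_period_eqI: "is_period m f \<Longrightarrow> m dvd x - y \<Longrightarrow> f x = f y"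
  using is_periodD[OF is_period_dvd, of m f "x - y" y] by simp

lemma is_period_mod: "is_period m f \<Longrightarrow> f (x mod m) = f x"
  by (rule is_period_eqI[of m]) (auto simp: mod_eq_dvd_iff[symmetric])

lemma is_period_comp_diff: "is_period m f \<Longrightarrow> is_period m (\<lambda>h. f (c - h))"
  by (auto simp: is_period_def intro!: is_period_eqI[of m f])

lemma is_period_comp_shift: "is_period m f \<Longrightarrow> is_period m (\<lambda>h. f (h - c))"
  by (auto simp: is_period_def intro!: is_period_eqI[of m f])

text \<open>Both \<open>\<phi>\<close> and its inverse \<open>\<psi>\<close> respect congruence
  modulo \<open>m\<close>, so \<open>\<phi>\<close> permutes the residues, and \<open>f\<close>
  depends only on the residue.\<close>

lemma sum_periodic_bij:
  fixes f :: "int \<Rightarrow> 'a::comm_monoid_add"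
  assumes "m > 0" "is_period m f"
    and \<phi>: "\<And>x. \<psi> (\<phi> x) = x" "\<And>x. \<phi> (\<psi> x) = x"
      "\<And>x y. m dvd x - y \<Longrightarrow> m dvd \<phi> x - \<phi> y" "\<And>x y. m dvd x - y \<Longrightarrow> m dvd \<psi> x - \<psi> y"
  shows "(\<Sum>h\<in>{0..<m}. f (\<phi> h)) = sum f {0..<m}"
proof (rule sum.reindex_bij_witness[where i = "\<lambda>h. \<psi> h mod m" and j = "\<lambda>h. \<phi> h mod m"])
  have eq: "\<phi> x mod m = \<phi> y mod m" "\<psi> x mod m = \<psi> y mod m" if "x mod m = y mod m" for x y
    using that \<phi>(3,4)[of x y] by (auto simp: mod_eq_dvd_iff)
  fix a assume a: "a \<in> {0..<m}"
  show "\<psi> (\<phi> a mod m) mod m = a"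
    using eq(2)[of "\<phi> a mod m" "\<phi> a"] a by (simp add: \<phi>)
  show "\<phi> (\<psi> a mod m) mod m = a"
    using eq(1)[of "\<psi> a mod m" "\<psi> a"] a by (simp add: \<phi>)
  show "f (\<phi> a mod m) = f (\<phi> a)"
    by (rule is_period_mod[OF assms(2)])
qed (use \<open>m > 0\<close> in auto)

lemma sum_periodic_shift:
  fixes f :: "int \<Rightarrow> 'a::comm_monoid_add"
  assumes "m > 0" "is_period m f"
  shows "(\<Sum>h\<in>{0..<m}. f (h - c)) = sum f {0..<m}"
  by (rule sum_periodic_bij[where \<psi> = "\<lambda>h. h + c"]) (use assms in auto)

lemma sum_periodic_reflect:
  fixes f :: "int \<Rightarrow> 'a::comm_monoid_add"
  assumes "m > 0" "is_period m f"
  shows "(\<Sum>h\<in>{0..<m}. f (c - h)) = sum f {0..<m}"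
  by (rule sum_periodic_bij[where \<psi> = "\<lambda>h. c - h"])
     (use assms in \<open>auto simp: dvd_diff_commute\<close>)

lemma sum_periodic_mult:
  fixes f :: "int \<Rightarrow> int"
  assumes "m > 0" "is_period m f"
  shows "sum f {0..<int k * m} = int k * sum f {0..<m}"
proof (induction k)
  case (Suc k)
  have "{0..<int (Suc k) * m} = {0..<int k * m} \<union> {int k * m..<int k * m + m}"
  proof -
    have "0 \<le> int k * m" using assms(1) by simp
    moreover have "int (Suc k) * m = int k * m + m" by (simp add: algebra_simps)
    ultimately show ?thesis using assms(1) by (simp add: ivl_disj_un)
  qed
  moreover have "sum f ({0..<int k * m} \<union> {int k * m..<int k * m + m})
      = sum f {0..<int k * m} + sum f {int k * m..<int k * m + m}"
    by (rule sum.union_disjoint) auto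
  moreover have "sum f {int k * m..<int k * m + m} = sum f {0..<m}"
    by (rule sum.reindex_bij_witness[where i = "\<lambda>h. h + int k * m" and j = "\<lambda>h. h - int k * m"])
       (auto intro!: is_period_eqI[OF assms(2)])
  ultimately show ?case
    using Suc by (simp add: algebra_simps)
qed simp

text \<open>The set is a subgroup of the integers: by division with remainder its least positive
  element generates it, and this generator divides \<open>p ^ \<alpha>\<close>. It serves both for
  the periods of a function and for the support of \<open>E\<close>.\<close>

lemma int_subgroup_prime_power:
  fixes S :: "int set" and p \<alpha> :: nat
  assumes p: "prime p" and S: "int p ^ \<alpha> \<in> S" "\<And>x y. x \<in> S \<Longrightarrow> y \<in> S \<Longrightarrow> x - y \<in> S"
  shows "\<exists>\<beta>\<le>\<alpha>. S = {x. int p ^ \<beta> dvd x}"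
proof -
  have zero: "0 \<in> S" using S(2)[OF S(1) S(1)] by simp
  have neg: "- x \<in> S" if "x \<in> S" for x using S(2)[OF zero that] by simp
  have add: "x + y \<in> S" if "x \<in> S" "y \<in> S" for x y using S(2)[OF that(1) neg[OF that(2)]] by simp
  have mult: "x * k \<in> S" if "x \<in> S" for x k
    by (induction k rule: int_induct[where k = 0]) (auto simp: algebra_simps zero that add intro: S(2))
  define d where "d = (LEAST d. d > 0 \<and> int d \<in> S)"
  have "p ^ \<alpha> > 0 \<and> int (p ^ \<alpha>) \<in> S" using S(1) p by (simp add: prime_gt_0_nat)
  from LeastI[of "\<lambda>d. d > 0 \<and> int d \<in> S", OF this]
  have d: "d > 0" "int d \<in> S" by (auto simp: d_def)
  have dvd: "int d dvd x" if "x \<in> S" for x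
  proof -
    have "x - int d * (x div int d) \<in> S" by (intro S(2) mult that d)
    hence "int (nat (x mod int d)) \<in> S"
      using d(1) by (simp add: minus_mult_div_eq_mod)
    moreover have "nat (x mod int d) < d"
      using d(1) by (simp add: nat_less_iff)
    ultimately have "\<not> nat (x mod int d) > 0"
      using not_less_Least[of "nat (x mod int d)" "\<lambda>d. d > 0 \<and> int d \<in> S"] by (auto simp: d_def)
    thus ?thesis using d(1) by (simp add: dvd_eq_mod_eq_0 not_less) (metis d(1) of_nat_0_less_iff order_antisym pos_mod_sign)
  qed
  have "d dvd p ^ \<alpha>" using dvd[OF S(1)] by (metis int_dvd_int_iff of_nat_power)
  then obtain \<beta> where \<beta>: "\<beta> \<le> \<alpha>" "d = p ^ \<beta>"
    using p by (auto simp: divides_primepow_nat)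
  have "S = {x. int p ^ \<beta> dvd x}"
    using dvd \<beta>(2) mult[OF d(2)] by auto
  thus ?thesis using \<beta>(1) by blast
qed

section \<open>Frobenius for cyclic convolution\<close>

text \<open>\<open>\<int>[x]\<close> modulo the ideal \<open>(p, x\<^sup>N - 1)\<close> stands in for the group ring of \<open>\<int> / N\<close> over the field
  with \<open>p\<close> elements, which is not a type since it depends on \<open>p\<close> and \<open>N\<close>.\<close>

definition fcong :: "nat \<Rightarrow> nat \<Rightarrow> int poly \<Rightarrow> int poly \<Rightarrow> bool" where
  "fcong p N a b \<longleftrightarrow> (\<exists>u v. a - b = (monom 1 N - 1) * u + of_nat p * v)"

lemma fcong_refl [simp]: "fcong p N a a"
  unfolding fcong_def by (rule exI[of _ 0], rule exI[of _ 0]) simp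

lemma fcong_sym: "fcong p N a b \<Longrightarrow> fcong p N b a"
  unfolding fcong_def
proof (elim exE)
  fix u v assume "a - b = (monom 1 N - 1) * u + of_nat p * v"
  hence "b - a = (monom 1 N - 1) * (- u) + of_nat p * (- v)" by (simp add: algebra_simps)
  thus "\<exists>u v. b - a = (monom 1 N - 1) * u + of_nat p * v" by blast
qed

lemma fcong_add: "fcong p N a b \<Longrightarrow> fcong p N c d \<Longrightarrow> fcong p N (a + c) (b + d)"
  unfolding fcong_def
proof (elim exE)
  fix u v u' v'
  assume "a - b = (monom 1 N - 1) * u + of_nat p * v" "c - d = (monom 1 N - 1) * u' + of_nat p * v'"
  hence "a + c - (b + d) = (monom 1 N - 1) * (u + u') + of_nat p * (v + v')"
    by (simp add: algebra_simps)
  thus "\<exists>u v. a + c - (b + d) = (monom 1 N - 1) * u + of_nat p * v" by blast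
qed

lemma fcong_trans [trans]: "fcong p N a b \<Longrightarrow> fcong p N b c \<Longrightarrow> fcong p N a c"
  using fcong_add[of p N a b b c] by (simp add: fcong_def)

lemma fcong_mult_left: "fcong p N a b \<Longrightarrow> fcong p N (c * a) (c * b)"
  unfolding fcong_def
proof (elim exE)
  fix u v
  assume "a - b = (monom 1 N - 1) * u + of_nat p * v"
  hence "c * (a - b) = c * ((monom 1 N - 1) * u + of_nat p * v)" by simp
  hence "c * a - c * b = (monom 1 N - 1) * (c * u) + of_nat p * (c * v)"
    by (simp add: algebra_simps)
  thus "\<exists>u v. c * a - c * b = (monom 1 N - 1) * u + of_nat p * v" by blast
qed

lemma fcong_mult: "fcong p N a b \<Longrightarrow> fcong p N c d \<Longrightarrow> fcong p N (a * c) (b * d)"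
  using fcong_mult_left[of p N c d a] fcong_mult_left[of p N a b d] fcong_trans
  by (metis mult.commute)

lemma fcong_sum: "(\<And>i. i \<in> S \<Longrightarrow> fcong p N (f i) (g i)) \<Longrightarrow> fcong p N (sum f S) (sum g S)"
  by (induction S rule: infinite_finite_induct) (auto intro: fcong_add)

lemma fcong_of_int: "int p dvd c - d \<Longrightarrow> fcong p N (of_int c) (of_int d)"
proof -
  assume "int p dvd c - d"
  then obtain k where "c - d = int p * k" by auto
  hence "(of_int c :: int poly) - of_int d = of_int (int p * k)"
    by (metis of_int_diff)
  hence "(of_int c :: int poly) - of_int d = (monom 1 N - 1) * 0 + of_nat p * of_int k"
    by simp
  thus ?thesis unfolding fcong_def by blast
qed

text \<open>The inner binomial coefficients are divisible by \<open>p\<close>, so the difference is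
  a multiple of \<open>p\<close> alone and the generator x^N - 1 enters with coefficient 0.\<close>

lemma fcong_frobenius_add:
  assumes "prime p"
  shows "fcong p N ((a + b) ^ p) (a ^ p + b ^ p)"
proof -
  have p: "p > 0" using assms by (simp add: prime_gt_0_nat)
  have "of_nat p dvd (\<Sum>k\<in>{0<..<p}. of_nat (p choose k) * a ^ k * b ^ (p - k))"
  proof (rule dvd_sum)
    fix k assume "k \<in> {0<..<p}"
    hence "p dvd p choose k" using assms by (intro dvd_choose_prime) auto
    hence "(of_nat p :: int poly) dvd of_nat (p choose k)" by (auto elim!: dvdE)
    thus "of_nat p dvd of_nat (p choose k) * a ^ k * b ^ (p - k)" by (simp add: dvd_mult2)
  qed
  then obtain v where v: "(\<Sum>k\<in>{0<..<p}. of_nat (p choose k) * a ^ k * b ^ (p - k)) = of_nat p * v" by auto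
  have "{..p} = insert 0 (insert p {0<..<p})" using p by auto
  hence "(a + b) ^ p = b ^ p + (a ^ p + of_nat p * v)"
    using p by (simp add: binomial_ring v)
  hence "(a + b) ^ p - (a ^ p + b ^ p) = (monom 1 N - 1) * 0 + of_nat p * v" by simp
  thus ?thesis unfolding fcong_def by blast
qed

lemma fcong_frobenius_sum:
  assumes "prime p"
  shows "fcong p N (sum f S ^ p) (\<Sum>i\<in>S. f i ^ p)"
proof (induction S rule: infinite_finite_induct)
  case (insert x F)
  have "fcong p N ((f x + sum f F) ^ p) (f x ^ p + sum f F ^ p)"
    by (rule fcong_frobenius_add[OF assms])
  also have "fcong p N \<dots> (f x ^ p + (\<Sum>i\<in>F. f i ^ p))"
    by (intro fcong_add insert.IH) auto
  finally show ?case using insert by simp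
\<comment> \<open>Sums over an empty or infinite set are 0, and \<open>0 ^ p = 0\<close> because
  \<open>p > 0\<close>.\<close>
qed (use prime_gt_0_nat[OF assms] in \<open>auto simp: power_0_left\<close>)

section \<open>Linear functionals on the polynomial quotient\<close>

text \<open>This is the linear functional sending x^i to \<open>u i\<close>. For
  \<open>N\<close>-periodic \<open>u\<close> it descends to the quotient with values modulo
  \<open>p\<close>, and so extracts integer congruences from \<open>fcong\<close>.\<close>

definition coeff_sum :: "(nat \<Rightarrow> int) \<Rightarrow> int poly \<Rightarrow> int" where
  "coeff_sum u f = (\<Sum>i\<le>degree f. coeff f i * u i)"

lemma coeff_sum_eq: "degree f \<le> K \<Longrightarrow> coeff_sum u f = (\<Sum>i\<le>K. coeff f i * u i)"
  unfolding coeff_sum_def by (rule sum.mono_neutral_left) (auto simp: coeff_eq_0)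

lemma coeff_sum_add: "coeff_sum u (f + g) = coeff_sum u f + coeff_sum u g"
  using degree_add_le_max[of f g]
  by (simp add: coeff_sum_eq[of _ "max (degree f) (degree g)"] sum.distrib algebra_simps)

lemma coeff_sum_of_int_mult: "coeff_sum u (of_int c * f) = c * coeff_sum u f"
proof -
  have "coeff_sum u (smult c f) = c * coeff_sum u f"
    by (simp add: coeff_sum_eq[of _ "degree f"] sum_distrib_left mult_ac)
  thus ?thesis by (simp add: of_int_poly)
qed

lemma coeff_sum_diff: "coeff_sum u (f - g) = coeff_sum u f - coeff_sum u g"
  using coeff_sum_add[of u "f - g" g] by simp

lemma coeff_sum_sum: "coeff_sum u (sum f S) = (\<Sum>i\<in>S. coeff_sum u (f i))"
  by (induction S rule: infinite_finite_induct) (auto simp: coeff_sum_add, auto simp: coeff_sum_def)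

lemma coeff_sum_monom: "coeff_sum u (monom 1 k) = u k"
  by (simp add: coeff_sum_def degree_monom_eq if_distrib[where f = "\<lambda>x. x * _"] cong: if_cong)

lemma coeff_sum_monom_mult:
  "coeff_sum u (monom 1 N * f) = coeff_sum (\<lambda>i. u (i + N)) f"
proof (cases "f = 0")
  case False
  have "coeff_sum u (monom 1 N * f) = (\<Sum>i\<le>degree f + N. coeff (monom 1 N * f) i * u i)"
    using degree_mult_le[of "monom 1 N" f] by (intro coeff_sum_eq) (simp add: degree_monom_eq)
  also have "\<dots> = (\<Sum>i\<in>{N..degree f + N}. coeff f (i - N) * u i)"
    by (rule sum.mono_neutral_cong_right) (auto simp: coeff_monom_mult)
  also have "\<dots> = (\<Sum>i\<le>degree f. coeff f i * u (i + N))"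
    by (rule sum.reindex_bij_witness[where i = "\<lambda>i. i + N" and j = "\<lambda>i. i - N"]) auto
  finally show ?thesis by (simp add: coeff_sum_def)
qed (simp add: coeff_sum_def)

text \<open>Multiplication by x^N shifts the argument of \<open>u\<close> by \<open>N\<close>, so
  for periodic \<open>u\<close> the functional kills all multiples of x^N - 1; multiples of
  \<open>p\<close> go to multiples of \<open>p\<close>.\<close>

lemma fcong_coeff_sum:
  assumes "fcong p N a b" and u: "\<And>i. u (i + N) = u i"
  shows "int p dvd coeff_sum u a - coeff_sum u b"
proof -
  obtain v w where vw: "a - b = (monom 1 N - 1) * v + of_nat p * w"
    using assms(1) by (auto simp: fcong_def)
  have "coeff_sum u ((monom 1 N - 1) * v) = 0"
    by (simp add: left_diff_distrib coeff_sum_diff coeff_sum_monom_mult u)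
  moreover have "coeff_sum u (of_nat p * w) = int p * coeff_sum u w"
    using coeff_sum_of_int_mult[of u "int p" w] by simp
  ultimately have "coeff_sum u (a - b) = int p * coeff_sum u w"
    by (simp add: vw coeff_sum_add)
  thus ?thesis by (simp add: coeff_sum_diff)
qed

lemma fcong_monom_mod: "fcong p N (monom 1 k) (monom 1 (k mod N))"
proof -
  have *: "fcong p N (monom 1 (r + N * q)) (monom 1 r)" for r q
  proof (induction q)
    case (Suc q)
    have "monom 1 (r + N * Suc q) - monom 1 (r + N * q) =
        (monom 1 N - 1 :: int poly) * monom 1 (r + N * q) + of_nat p * 0"
      by (simp add: algebra_simps mult_monom)
    hence "fcong p N (monom 1 (r + N * Suc q)) (monom 1 (r + N * q))" unfolding fcong_def by blast
    thus ?case using Suc by (rule fcong_trans)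
  qed simp
  show ?thesis using *[of "k mod N" "k div N"] by simp
qed

section \<open>Cyclic convolution and group elements in the quotient ring\<close>

text \<open>Only \<open>h\<close> runs over representatives, while \<open>x - h\<close> is left
  unreduced; for \<open>m\<close>-periodic functions this is convolution on the integers modulo
  \<open>m\<close>.\<close>

definition cconv :: "int \<Rightarrow> (int \<Rightarrow> int) \<Rightarrow> (int \<Rightarrow> int) \<Rightarrow> int \<Rightarrow> int" where
  "cconv m f g x = (\<Sum>h\<in>{0..<m}. f h * g (x - h))"

text \<open>The group element \<open>z\<close> inside the group ring. Reducing the exponent modulo
  \<open>N\<close> gives negative \<open>z\<close> a meaning as well.\<close>

definition xpow :: "nat \<Rightarrow> int \<Rightarrow> int poly" where
  "xpow N z = monom 1 (nat (z mod int N))"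

lemma is_period_xpow: "is_period (int N) (xpow N)"
  by (simp add: is_period_def xpow_def)

lemma fcong_xpow_mult:
  assumes "N > 0"
  shows "fcong p N (xpow N a * xpow N b) (xpow N (a + b))"
proof -
  have "xpow N a * xpow N b = monom 1 (nat (a mod int N) + nat (b mod int N))"
    by (simp add: xpow_def mult_monom)
  moreover have "(nat (a mod int N) + nat (b mod int N)) mod N = nat ((a + b) mod int N)"
    using assms by (simp add: nat_eq_iff2 zmod_int mod_simps flip: nat_add_distrib)
  ultimately show ?thesis
    using fcong_monom_mod[of p N "nat (a mod int N) + nat (b mod int N)"] by (simp add: xpow_def)
qed

lemma fcong_xpow_power:
  assumes "N > 0"
  shows "fcong p N (xpow N a ^ k) (xpow N (int k * a))"
proof (induction k)
  case 0
  then show ?case by (simp add: xpow_def monom_0 flip: one_pCons)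
next
  case (Suc k)
  have "fcong p N (xpow N a * xpow N a ^ k) (xpow N a * xpow N (int k * a))"
    by (rule fcong_mult_left[OF Suc])
  also have "fcong p N \<dots> (xpow N (a + int k * a))"
    by (rule fcong_xpow_mult[OF assms])
  finally show ?case by (simp add: algebra_simps)
qed

text \<open>With the indicator of the residue class of \<open>g\<close> as weight, the functional
  reads off the coefficient of the group element \<open>g\<close>.\<close>

lemma coeff_sum_xpow:
  assumes "N > 0"
  shows "coeff_sum (\<lambda>i. if int N dvd int i - g then 1 else 0) (xpow N z) =
    (if int N dvd z - g then 1 else 0)"
  using assms by (simp add: xpow_def coeff_sum_monom flip: mod_eq_dvd_iff)

lemma fermat_int:
  assumes "prime p"
  shows "int p dvd a ^ p - a"
proof (cases "int p dvd a")
  case True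
  then show ?thesis
    using prime_gt_0_nat[OF assms] by (simp add: dvd_power_le dvd_trans[OF True dvd_power])
next
  case False
  \<comment> \<open>\<open>fermat_theorem\<close> speaks about naturals, so it is applied to the
    residue of \<open>a\<close>.\<close>
  have "[nat (a mod int p) ^ (p - 1) = 1] (mod p)"
  proof (rule fermat_theorem[OF assms])
    have "\<not> int p dvd int (nat (a mod int p))"
      using False prime_gt_0_nat[OF assms] by (simp add: dvd_mod_iff)
    thus "\<not> p dvd nat (a mod int p)" by (simp only: int_dvd_int_iff) simp
  qed
  hence "[int (nat (a mod int p) ^ (p - 1)) = int 1] (mod int p)"
    by (simp only: cong_int_iff)
  hence "[a ^ (p - 1) = 1] (mod int p)"
    using prime_gt_0_nat[OF assms] by (simp add: cong_def power_mod)
  hence "[a * a ^ (p - 1) = a * 1] (mod int p)" by (rule cong_scalar_left)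
  moreover have "a * a ^ (p - 1) = a ^ p"
    using prime_gt_0_nat[OF assms] by (simp flip: power_Suc)
  ultimately show ?thesis by (simp add: cong_iff_dvd_diff)
qed

text \<open>The \<open>p\<close>-th convolution power of \<open>w\<close> is computed modulo \<open>p\<close> in two ways: by the quadratic
  relation it is \<open>r\<^bsup>p - 1\<^esup> w\<close> plus a constant, by Frobenius it is the push-forward of \<open>w\<close>
  under multiplication by \<open>p\<close>.\<close>

lemma frobenius_quadratic_cconv:
  fixes w :: "int \<Rightarrow> int"
  assumes p: "prime p" and N: "N > 0" and w: "is_period (int N) w"
    and quad: "\<And>x. cconv (int N) w w x = r * w x + m"
  shows "\<exists>c. \<forall>g. int p dvd
    (\<Sum>h\<in>{0..<int N}. if int N dvd int p * h - g then w h else 0) - (r ^ (p - 1) * w g + c)"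
proof -
  \<comment> \<open>\<open>F\<close> is \<open>w\<close> as an element of the group ring,
    \<open>T\<close> is the sum of all group elements, and \<open>s\<close> is the coefficient sum
    of \<open>F\<close>.\<close>
  define F where "F = (\<Sum>h\<in>{0..<int N}. of_int (w h) * xpow N h)"
  define T where "T = (\<Sum>h\<in>{0..<int N}. xpow N h)"
  define s where "s = (\<Sum>h\<in>{0..<int N}. w h)"
  have N': "int N > 0" using N by simp
  \<comment> \<open>Multiplication by a group element permutes the terms of \<open>T\<close>, so
    \<open>F\<close> acts on \<open>T\<close> as the scalar \<open>s\<close>.\<close>
  have T: "fcong p N (F * T) (of_int s * T)"
  proof -
    have "F * T = (\<Sum>a\<in>{0..<int N}. \<Sum>b\<in>{0..<int N}. of_int (w a) * (xpow N a * xpow N b))"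
      by (simp add: F_def T_def sum_product mult.assoc)
    also have "fcong p N \<dots> (\<Sum>a\<in>{0..<int N}. \<Sum>b\<in>{0..<int N}. of_int (w a) * xpow N (b - (- a)))"
      using fcong_xpow_mult[OF N, of p] by (intro fcong_sum fcong_mult_left) (simp add: add.commute)
    also have "(\<Sum>a\<in>{0..<int N}. \<Sum>b\<in>{0..<int N}. of_int (w a) * xpow N (b - (- a))) =
        (\<Sum>a\<in>{0..<int N}. of_int (w a) * T)"
      unfolding T_def sum_distrib_left[symmetric]
      by (subst sum_periodic_shift[OF N' is_period_xpow]) simp
    finally show ?thesis by (simp add: s_def sum_distrib_right)
  qed
  have FF: "fcong p N (F * F) (of_int r * F + of_int m * T)"
  proof -
    have "F * F = (\<Sum>a\<in>{0..<int N}. \<Sum>b\<in>{0..<int N}. of_int (w a * w b) * (xpow N a * xpow N b))"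
      by (simp add: F_def sum_product mult_ac)
    also have "fcong p N \<dots> (\<Sum>a\<in>{0..<int N}. \<Sum>b\<in>{0..<int N}. of_int (w a * w b) * xpow N (a + b))"
      using fcong_xpow_mult[OF N, of p] by (intro fcong_sum fcong_mult_left) simp
    also have "(\<Sum>a\<in>{0..<int N}. \<Sum>b\<in>{0..<int N}. of_int (w a * w b) * xpow N (a + b)) =
        (\<Sum>a\<in>{0..<int N}. \<Sum>b\<in>{0..<int N}. of_int (w a * w (b - a)) * xpow N b)"
    proof (rule sum.cong[OF refl])
      fix a
      let ?f = "\<lambda>b. of_int (w a * w (b - a)) * xpow N b"
      have "is_period (int N) ?f"
        using is_period_comp_shift[OF w, of a] is_period_xpow[of N] by (simp add: is_period_def)
      from sum_periodic_shift[OF N' this, of "- a"]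
      show "(\<Sum>b\<in>{0..<int N}. of_int (w a * w b) * xpow N (a + b)) = sum ?f {0..<int N}"
        by (simp add: add.commute)
    qed
    also have "\<dots> = (\<Sum>b\<in>{0..<int N}. of_int (cconv (int N) w w b) * xpow N b)"
      by (subst sum.swap) (simp add: cconv_def sum_distrib_right)
    also have "\<dots> = of_int r * F + of_int m * T"
      by (simp add: quad F_def T_def sum_distrib_left sum.distrib algebra_simps)
    finally show ?thesis .
  qed
  \<comment> \<open>Powers of \<open>F\<close> stay in the span of \<open>F\<close> and
    \<open>T\<close>: \<open>FF\<close> rewrites \<open>F * F\<close>, and \<open>F * T\<close> is a
    multiple of \<open>T\<close>. The coefficient of \<open>F\<close> is a power of
    \<open>r\<close>; that of \<open>T\<close> is not tracked.\<close>
  have pow: "\<exists>c. fcong p N (F ^ Suc k) (of_int (r ^ k) * F + of_int c * T)" for k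
  proof (induction k)
    case 0
    show ?case by (rule exI[of _ 0]) simp
  next
    case (Suc k)
    then obtain c where "fcong p N (F ^ Suc k) (of_int (r ^ k) * F + of_int c * T)" by blast
    hence "fcong p N (F * F ^ Suc k) (F * (of_int (r ^ k) * F + of_int c * T))"
      by (rule fcong_mult_left)
    also have "\<dots> = of_int (r ^ k) * (F * F) + of_int c * (F * T)"
      by (simp add: algebra_simps)
    also have "fcong p N \<dots> (of_int (r ^ k) * (of_int r * F + of_int m * T) + of_int c * (of_int s * T))"
      by (intro fcong_add fcong_mult_left FF T)
    also have "\<dots> = of_int (r ^ Suc k) * F + of_int (r ^ k * m + c * s) * T"
      by (simp add: algebra_simps)
    finally show ?case by (intro exI) (simp only: power_Suc)
  qed
  obtain c where c: "fcong p N (F ^ p) (of_int (r ^ (p - 1)) * F + of_int c * T)"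
    using pow[of "p - 1"] prime_gt_0_nat[OF p] by auto
  have "fcong p N (F ^ p) (\<Sum>h\<in>{0..<int N}. (of_int (w h) * xpow N h) ^ p)"
    unfolding F_def by (rule fcong_frobenius_sum[OF p])
  also have "\<dots> = (\<Sum>h\<in>{0..<int N}. of_int (w h ^ p) * xpow N h ^ p)"
    by (simp add: power_mult_distrib)
  \<comment> \<open>Fermat turns the coefficient \<open>w h ^ p\<close> back into
    \<open>w h\<close>, while the power of the group element \<open>h\<close> is
    \<open>p * h\<close>; this is the push-forward.\<close>
  also have "fcong p N \<dots> (\<Sum>h\<in>{0..<int N}. of_int (w h) * xpow N (int p * h))"
    by (intro fcong_sum fcong_mult fcong_of_int fermat_int p fcong_xpow_power N)
  finally have *: "fcong p N (\<Sum>h\<in>{0..<int N}. of_int (w h) * xpow N (int p * h))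
      (of_int (r ^ (p - 1)) * F + of_int c * T)"
    using c fcong_sym fcong_trans by blast
  have "int p dvd (\<Sum>h\<in>{0..<int N}. if int N dvd int p * h - g then w h else 0) -
      (r ^ (p - 1) * w g + c)" for g
  proof -
    let ?u = "\<lambda>i. if int N dvd int i - g then 1 else 0 :: int"
    have "?u (i + N) = ?u i" for i
    proof -
      have "int (i + N) - g = (int i - g) + int N" by simp
      thus ?thesis by (simp only: dvd_add_left_iff dvd_refl)
    qed
    from fcong_coeff_sum[where u = ?u, OF * this]
    have "int p dvd coeff_sum ?u (\<Sum>h\<in>{0..<int N}. of_int (w h) * xpow N (int p * h)) -
        coeff_sum ?u (of_int (r ^ (p - 1)) * F + of_int c * T)" .
    also have "coeff_sum ?u (\<Sum>h\<in>{0..<int N}. of_int (w h) * xpow N (int p * h)) =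
        (\<Sum>h\<in>{0..<int N}. if int N dvd int p * h - g then w h else 0)"
      by (auto simp: coeff_sum_sum coeff_sum_of_int_mult coeff_sum_xpow[OF N] intro!: sum.cong)
    also have "coeff_sum ?u (of_int (r ^ (p - 1)) * F + of_int c * T) = r ^ (p - 1) * w g + c"
    proof -
      have iff: "int N dvd h - g \<longleftrightarrow> h = g mod int N" if "h \<in> {0..<int N}" for h
        using that by (auto simp flip: mod_eq_dvd_iff)
      have in_range: "g mod int N \<in> {0..<int N}" using N by simp
      have "coeff_sum ?u F = (\<Sum>h\<in>{0..<int N}. if h = g mod int N then w h else 0)"
        unfolding F_def coeff_sum_sum coeff_sum_of_int_mult coeff_sum_xpow[OF N]
        by (intro sum.cong) (auto simp: iff)
      hence "coeff_sum ?u F = w g" using in_range is_period_mod[OF w, of g] by (simp add: sum.delta)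
      moreover have "coeff_sum ?u T = (\<Sum>h\<in>{0..<int N}. if h = g mod int N then 1 else 0)"
        unfolding T_def coeff_sum_sum coeff_sum_xpow[OF N]
        by (intro sum.cong) (auto simp: iff)
      hence "coeff_sum ?u T = 1" using in_range by (simp add: sum.delta)
      ultimately show ?thesis by (simp only: coeff_sum_add coeff_sum_of_int_mult)
    qed
    finally show ?thesis .
  qed
  thus ?thesis by blast
qed

section \<open>Quadratic convolution equations\<close>

lemma cconv_comm:
  assumes "m > 0" "is_period m f" "is_period m g"
  shows "cconv m f g x = cconv m g f x"
proof -
  have "is_period m (\<lambda>h. f h * g (x - h))"
    using is_periodD[OF assms(2)] is_periodD[OF is_period_comp_diff[OF assms(3)]]
    by (simp add: is_period_def)
  from sum_periodic_reflect[OF assms(1) this, of x] show ?thesis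
    by (simp add: cconv_def mult.commute)
qed

lemma cconv_reflect:
  assumes "m > 0" "is_period m f" "is_period m g"
  shows "cconv m (\<lambda>x. f (- x)) (\<lambda>x. g (- x)) x = cconv m f g (- x)"
proof -
  have "is_period m (\<lambda>h. f h * g (- x - h))"
    using is_periodD[OF assms(2)] is_periodD[OF is_period_comp_diff[OF assms(3)]]
    by (simp add: is_period_def)
  from sum_periodic_reflect[OF assms(1) this, of 0] show ?thesis
    by (simp add: cconv_def)
qed

text \<open>The variable \<open>x\<close> enters only through \<open>g (x - h)\<close>, so every
  period of \<open>g\<close>, possibly smaller than \<open>m\<close>, passes to the
  convolution.\<close>

lemma is_period_cconv: "is_period a g \<Longrightarrow> is_period a (cconv m f g)"
  using is_periodD[of a g] by (simp add: is_period_def cconv_def add_diff_eq diff_add_eq[symmetric])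

text \<open>Equality in Cauchy-Schwarz for \<open>W\<close> and its reflected translate.\<close>

lemma period_of_cconv_self:
  fixes W :: "int \<Rightarrow> int"
  assumes m: "m > 0" and W: "is_period m W" and sym: "\<And>x. W (- x) = W x"
    and eq: "cconv m W W g = cconv m W W 0"
  shows "is_period g W"
proof -
  have W': "is_period m (\<lambda>h. W (g - h))" by (rule is_period_comp_diff[OF W])
  have sq: "is_period m (\<lambda>h. (W h)\<^sup>2)" using W by (simp add: is_period_def)
  have "cconv m W W 0 = (\<Sum>h\<in>{0..<m}. (W h)\<^sup>2)"
    by (simp add: cconv_def sym power2_eq_square)
  moreover have "(\<Sum>h\<in>{0..<m}. (W (g - h))\<^sup>2) = (\<Sum>h\<in>{0..<m}. (W h)\<^sup>2)"
    using sum_periodic_reflect[OF m sq] .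
  \<comment> \<open>By \<open>eq\<close> the cross term cancels the two equal square sums, so this
    sum of squares vanishes termwise.\<close>
  moreover have "(\<Sum>h\<in>{0..<m}. (W h - W (g - h))\<^sup>2) =
      (\<Sum>h\<in>{0..<m}. (W h)\<^sup>2) + (\<Sum>h\<in>{0..<m}. (W (g - h))\<^sup>2) - 2 * cconv m W W g"
    by (simp add: cconv_def power2_diff sum.distrib sum_subtractf sum_distrib_left mult.assoc)
  ultimately have "(\<Sum>h\<in>{0..<m}. (W h - W (g - h))\<^sup>2) = 0" using eq by simp
  hence *: "W h = W (g - h)" if "h \<in> {0..<m}" for h
    using that by (subst (asm) sum_nonneg_eq_0_iff) auto
  have "W h = W (g - h)" for h
    using *[of "h mod m"] m is_period_mod[OF W, of h] is_period_mod[OF W', of h] by simp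
  \<comment> \<open>Evenness turns invariance under the reflection at \<open>g\<close> into
    invariance under translation by \<open>g\<close>.\<close>
  from this[of "- _"] show ?thesis
    by (simp add: is_period_def sym add.commute)
qed

section \<open>Classification of even weights with a quadratic relation\<close>

text \<open>Each pair \<open>x\<close>, \<open>\<sigma> x\<close> contributes
  \<open>2 * W x\<close>. The involution used below is \<open>N - h\<close> on nonzero residues,
  which has no fixed point for odd \<open>N\<close>.\<close>

lemma even_sum_of_involution:
  fixes W :: "int \<Rightarrow> int" and S :: "int set"
  assumes "finite S" "\<And>x. x \<in> S \<Longrightarrow> \<sigma> x \<in> S" "\<And>x. x \<in> S \<Longrightarrow> \<sigma> (\<sigma> x) = x"
    "\<And>x. x \<in> S \<Longrightarrow> \<sigma> x \<noteq> x" "\<And>x. x \<in> S \<Longrightarrow> W (\<sigma> x) = W x"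
  shows "even (sum W S)"
  using assms
proof (induction "card S" arbitrary: S rule: less_induct)
  case less
  show ?case
  proof (cases "S = {}")
    case False
    then obtain a where a: "a \<in> S" by auto
    have eq: "S = insert a (insert (\<sigma> a) (S - {a, \<sigma> a}))"
      using a less.prems by auto
    have "even (sum W (S - {a, \<sigma> a}))"
    proof (rule less.hyps)
      show "card (S - {a, \<sigma> a}) < card S"
        using a less.prems(1) by (intro psubset_card_mono) auto
      show "\<sigma> x \<in> S - {a, \<sigma> a}" if "x \<in> S - {a, \<sigma> a}" for x
        using that a less.prems(2,3) by (metis Diff_iff insertCI insertE singletonD)
    qed (use less.prems in auto)
    moreover have "sum W S = W a + (W (\<sigma> a) + sum W (S - {a, \<sigma> a}))"
    proof -
      have "sum W (insert a (insert (\<sigma> a) (S - {a, \<sigma> a}))) = W a + sum W (insert (\<sigma> a) (S - {a, \<sigma> a}))"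
        using less.prems(1) less.prems(4)[OF a] by (intro sum.insert) auto
      also have "sum W (insert (\<sigma> a) (S - {a, \<sigma> a})) = W (\<sigma> a) + sum W (S - {a, \<sigma> a})"
        using less.prems(1) by (intro sum.insert) auto
      finally show ?thesis using eq by simp
    qed
    ultimately show ?thesis using less.prems(5)[OF a] by simp
  qed simp
qed

lemma sum_if_dvd:
  fixes b m :: int
  assumes "b > 0" "b dvd m" "m > 0"
  shows "(\<Sum>h\<in>{0..<m}. if b dvd h then 1 else 0) = m div b"
proof -
  obtain k where k: "m = b * k" using assms by auto
  have "k > 0" using assms k by (simp add: zero_less_mult_iff)
  then obtain j where j: "k = int j" by (metis zero_less_imp_eq_int)
  have "is_period b (\<lambda>h. if b dvd h then 1 else 0 :: int)"
    by (simp add: is_period_def)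
  from sum_periodic_mult[OF assms(1) this, of j]
  have "(\<Sum>h\<in>{0..<m}. if b dvd h then 1 else 0 :: int) = k * (\<Sum>h\<in>{0..<b}. if b dvd h then 1 else 0)"
    by (simp add: k j mult.commute)
  also have "(\<Sum>h\<in>{0..<b}. if b dvd h then 1 else 0 :: int) = (\<Sum>h\<in>{0..<b}. if h = 0 then 1 else 0)"
    using assms(1) by (intro sum.cong) (auto dest: zdvd_imp_le)
  also have "\<dots> = 1" using assms(1) by (simp add: sum.delta)
  finally show ?thesis using k assms(1) by simp
qed

text \<open>The Frobenius congruence makes \<open>W\<close> constant on the residues prime to
  \<open>p\<close>. The constant 0 contradicts \<open>one\<close> by a mass count; for the constant
  1, counting and parity applied to \<open>W - 1\<close> exclude any deviation.\<close>

lemma quadratic_weight_classification: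
  fixes W :: "int \<Rightarrow> int"
  assumes p: "prime p" "odd p" and \<gamma>: "\<gamma> \<ge> 1" and N: "N = int p ^ \<gamma>"
    and W: "is_period N W" and sym: "\<And>x. W (- x) = W x"
    and range: "\<And>x. W x \<in> {0, 1, 2}" and two: "\<And>x. W x = 2 \<longleftrightarrow> N dvd x"
    and one: "\<exists>x. W x = 1"
    and quad: "\<And>x. cconv N W W x = r * W x + c"
  shows "(\<forall>x. \<not> N dvd x \<longrightarrow> W x = 1) \<and> r = 1"
proof -
  have p2: "p > 2" using p prime_ge_2_nat[of p] by (cases "p = 2") auto
  have pN: "int p dvd N" using \<gamma> N by (simp add: dvd_power)
  have Npos: "N > 0" using N p2 by simp
  have pdvd: "int p dvd N * k + x \<longleftrightarrow> int p dvd x" for k x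
    using pN by (simp add: dvd_add_right_iff)
  have N_not: "\<not> N dvd x" if "\<not> int p dvd x" for x using that pN dvd_trans by blast
  have W0: "W 0 = 2" using two[of 0] by simp
  have W01: "W x = 0 \<or> W x = 1" if "\<not> N dvd x" for x using range[of x] two[of x] that by auto
  have nonneg: "W x \<ge> 0" for x using range[of x] by auto
  have W01': "W x = 0 \<or> W x = 1" if "x \<in> {0<..<N}" for x
    using W01[of x] that zdvd_not_zless[of x N] by auto
  have mod_range: "x mod N \<in> {0<..<N}" if "\<not> N dvd x" for x
    using that pos_mod_sign[OF Npos, of x] pos_mod_bound[OF Npos, of x]
    by (auto simp: dvd_eq_mod_eq_0)
  have p1: "\<not> int p dvd 1" using p2 by simp
  have "\<exists>c. \<forall>g. int p dvd
      (\<Sum>h\<in>{0..<int (p ^ \<gamma>)}. if int (p ^ \<gamma>) dvd int p * h - g then W h else 0) - (r ^ (p - 1) * W g + c)"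
    by (rule frobenius_quadratic_cconv[OF p(1), where m = c])
       (use W quad N p2 in auto)
  then obtain d where d: "int p dvd
      (\<Sum>h\<in>{0..<N}. if N dvd int p * h - g then W h else 0) - (r ^ (p - 1) * W g + d)" for g
    by (auto simp: N)
  \<comment> \<open>If \<open>p\<close> does not divide \<open>g\<close>, no \<open>p * h\<close> is
    congruent to \<open>g\<close> modulo \<open>N\<close>, so the push-forward vanishes at
    \<open>g\<close>.\<close>
  have off: "int p dvd r ^ (p - 1) * W g + d" if "\<not> int p dvd g" for g
  proof -
    have "\<not> N dvd int p * h - g" for h
      using that pN dvd_trans[of "int p" N "int p * h - g"] dvd_diff_right_iff[of "int p" "int p * h" g]
      by auto
    hence "int p dvd - (r ^ (p - 1) * W g + d)" using d[of g] by simp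
    thus ?thesis by (simp only: dvd_minus_iff)
  qed
  \<comment> \<open>If \<open>p\<close> divided \<open>r\<close>, the congruences at 1 and at 0
    would make the sum of \<open>W\<close> over the \<open>p\<close> residues killed by
    \<open>p\<close> divisible by \<open>p\<close>. That sum is \<open>2 + e\<close> with
    \<open>e\<close> even and between 0 and \<open>p - 1\<close>, so it would equal the odd number
    \<open>p\<close>.\<close>
  have r: "\<not> int p dvd r"
  proof
    assume "int p dvd r"
    hence rp: "int p dvd r ^ (p - 1)" using p2 by (simp add: dvd_power_le dvd_trans[OF _ dvd_power])
    hence "int p dvd d" using off[OF p1] by (simp add: dvd_add_right_iff)
    hence "int p dvd r ^ (p - 1) * W 0 + d" using rp by simp
    from dvd_add[OF d[of 0] this]
    have "int p dvd (\<Sum>h\<in>{0..<N}. if N dvd int p * h then W h else 0)" by simp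
    also define M where "M = N div int p"
    have M: "N = int p * M" using pN by (simp add: M_def)
    have Mpos: "M > 0" using M Npos p2 by (simp add: zero_less_mult_iff)
    define K where "K = {0<..<N} \<inter> {h. M dvd h}"
    have fin: "finite K" "0 \<notin> K" by (auto simp: K_def)
    have "(\<Sum>h\<in>{0..<N}. if N dvd int p * h then W h else 0) =
        (\<Sum>h\<in>{h\<in>{0..<N}. M dvd h}. W h)"
      using p2 by (simp add: M sum.If_cases Int_def)
    also have "{h\<in>{0..<N}. M dvd h} = insert 0 K" using Npos by (auto simp: K_def)
    also have "(\<Sum>h\<in>insert 0 K. W h) = 2 + (\<Sum>h\<in>K. W h)"
      using fin by (simp add: W0)
    finally have dv: "int p dvd 2 + (\<Sum>h\<in>K. W h)" .
    define e where "e = (\<Sum>h\<in>K. W h)"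
    have "even e" unfolding e_def
    proof (rule even_sum_of_involution[where \<sigma> = "\<lambda>h. N - h"])
      have "odd N" using p N by simp
      thus "N - x \<noteq> x" for x by presburger
      show "W (N - x) = W x" for x
        using sym[of "x"] is_periodD[OF W, of "- x"] by (simp add: add.commute)
    qed (auto simp: M K_def)
    have "e \<ge> 0" unfolding e_def by (intro sum_nonneg nonneg)
    have "e \<le> (\<Sum>h\<in>K. 1)"
      unfolding e_def using W01' by (intro sum_mono) (force simp: K_def)
    also have "\<dots> + 1 = (\<Sum>h\<in>insert 0 K. 1)" using fin by simp
    also have "insert 0 K = {h\<in>{0..<N}. M dvd h}" using Npos by (auto simp: K_def)
    also have "(\<Sum>h\<in>{h\<in>{0..<N}. M dvd h}. 1) = (\<Sum>h\<in>{0..<N}. if M dvd h then 1 else 0 :: int)"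
      by (simp add: sum.If_cases Int_def)
    also have "\<dots> = int p" using sum_if_dvd[OF Mpos, of N] Npos M Mpos by simp
    finally have "e \<le> int p - 1" by simp
    obtain k where k: "2 + e = int p * k" using dv by (auto simp: e_def)
    have "int p * 0 < int p * k" "int p * k < int p * 2"
      using k \<open>e \<ge> 0\<close> \<open>e \<le> int p - 1\<close> p2 by linarith+
    hence "k = 1" using p2 by (simp only: mult_less_cancel_left) auto
    hence "2 + e = int p" using k by simp
    thus False using \<open>even e\<close> p(2) by presburger
  qed
  \<comment> \<open>As \<open>p\<close> does not divide \<open>r\<close>, \<open>off\<close>
    determines \<open>W\<close> modulo \<open>p\<close>; values of \<open>W\<close> differ by at
    most 2, which is less than \<open>p\<close>.\<close>
  have const: "W g = W 1" if "\<not> int p dvd g" for g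
  proof -
    have "int p dvd (r ^ (p - 1) * W g + d) - (r ^ (p - 1) * W 1 + d)"
      by (intro dvd_diff off that p1)
    hence "int p dvd r ^ (p - 1) * (W g - W 1)" by (simp add: algebra_simps)
    moreover have "prime (int p)" using p by simp
    ultimately have dv: "int p dvd W g - W 1"
      using r prime_dvd_power[of "int p" r] by (auto simp: prime_dvd_mult_iff)
    moreover have "\<bar>W g - W 1\<bar> < int p" using range[of g] range[of 1] p2 by auto
    ultimately show ?thesis using zdvd_not_zless[of "\<bar>W g - W 1\<bar>" "int p"] by auto
  qed
  define s where "s = sum W {0..<N}"
  have total: "(\<Sum>x\<in>{0..<N}. cconv N f f x) = (sum f {0..<N})\<^sup>2" if "is_period N f" for f
  proof -
    have "(\<Sum>x\<in>{0..<N}. cconv N f f x) = (\<Sum>h\<in>{0..<N}. f h * (\<Sum>x\<in>{0..<N}. f (x - h)))"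
      unfolding cconv_def by (subst sum.swap) (simp add: sum_distrib_left)
    thus ?thesis
      by (simp add: sum_periodic_shift[OF Npos that] power2_eq_square flip: sum_distrib_right)
  qed
  have split: "sum f {0..<N} = f 0 + sum f {0<..<N}" for f :: "int \<Rightarrow> int"
  proof -
    have "{0..<N} = insert 0 {0<..<N}" using Npos by auto
    thus ?thesis by simp
  qed
  have conv0: "cconv N f f 0 = (\<Sum>x\<in>{0..<N}. (f x)\<^sup>2)" if "\<And>x. f (- x) = f x" for f
    by (simp add: cconv_def that power2_eq_square)
  have not_both: "int p dvd h \<Longrightarrow> \<not> int p dvd 1 - h" for h
    using p1 by (simp add: dvd_diff_left_iff)
  \<comment> \<open>Otherwise \<open>W\<close> vanishes off the multiples of \<open>p\<close>. Then
    the relation at 1 gives \<open>c = 0\<close>, its total mass gives \<open>r = s\<close>, and its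
    value at 0 leaves no mass outside 0, against \<open>one\<close>.\<close>
  have "W 1 = 1"
  proof (rule ccontr)
    assume "W 1 \<noteq> 1"
    hence W1: "W 1 = 0" using W01[of 1] N_not[OF p1] by auto
    have "cconv N W W 1 = 0"
      unfolding cconv_def
      using const W1 not_both by (intro sum.neutral) (metis mult_eq_0_iff)
    hence c: "c = 0" using quad[of 1] W1 by simp
    have "s\<^sup>2 = r * s" using total[OF W] by (simp add: quad c s_def sum_distrib_left)
    moreover have pos: "sum W {0<..<N} \<ge> 0" by (intro sum_nonneg nonneg)
    hence "s > 0" unfolding s_def split W0 by simp
    ultimately have "r = s" by (simp add: power2_eq_square)
    moreover have "(\<Sum>x\<in>{0<..<N}. (W x)\<^sup>2) = sum W {0<..<N}"
      using W01' by (intro sum.cong) (force simp: power2_eq_square)+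
    hence "cconv N W W 0 = 4 + sum W {0<..<N}"
      unfolding conv0[of W, OF sym] split[of "\<lambda>x. (W x)\<^sup>2"] W0 by simp
    ultimately have "sum W {0<..<N} = 0"
      using quad[of 0] c W0 unfolding s_def split by simp
    hence z: "W x = 0" if "x \<in> {0<..<N}" for x
      using that nonneg by (subst (asm) sum_nonneg_eq_0_iff) auto
    have "W x \<noteq> 1" for x
      using z[OF mod_range, of x] is_period_mod[OF W, of x] two[of x] by auto
    thus False using one by blast
  qed
  \<comment> \<open>Subtracting the generic value leaves a function supported on multiples of
    \<open>p\<close>, equal to 1 at 0 and to 0 or -1 at the other residues.\<close>
  define V where "V x = W x - 1" for x
  have V: "is_period N V" using W by (simp add: V_def is_period_def)
  have Vsym: "V (- x) = V x" for x by (simp add: V_def sym)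
  have VVq: "cconv N V V x = r * V x + (r + c - 2 * s + N)" for x
  proof -
    have "(\<Sum>h\<in>{0..<N}. W (x - h)) = s"
      unfolding s_def by (rule sum_periodic_reflect[OF Npos W])
    hence "cconv N V V x = cconv N W W x - 2 * s + N"
      using Npos by (simp add: cconv_def V_def algebra_simps sum.distrib sum_subtractf s_def)
    thus ?thesis by (simp add: quad V_def algebra_simps)
  qed
  \<comment> \<open>Since \<open>h\<close> and \<open>1 - h\<close> are never both multiples of
    \<open>p\<close>, evaluating at 1 kills the constant term of the relation for
    \<open>V\<close>.\<close>
  have "cconv N V V 1 = 0"
    unfolding cconv_def
  proof (intro sum.neutral ballI)
    fix h
    show "V h * V (1 - h) = 0"
      using const[of h] const[of "1 - h"] not_both[of h] \<open>W 1 = 1\<close> by (auto simp: V_def)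
  qed
  moreover have "V 1 = 0" using \<open>W 1 = 1\<close> by (simp add: V_def)
  ultimately have "r + c - 2 * s + N = 0" using VVq[of 1] by simp
  hence VV: "cconv N V V x = r * V x" for x using VVq[of x] by simp
  \<comment> \<open>\<open>k\<close> counts the residues where \<open>V\<close> is -1. The relation
    at 0 gives \<open>r = 1 + k\<close>, and the total mass \<open>1 - k\<close> satisfies
    \<open>(1 - k)^2 = (1 + k)(1 - k)\<close>; hence \<open>k\<close> is 0 or 1, and parity leaves
    0.\<close>
  define k where "k = (\<Sum>x\<in>{0<..<N}. (V x)\<^sup>2)"
  have V0: "V 0 = 1" by (simp add: V_def W0)
  have V01: "V x = - ((V x)\<^sup>2)" if "x \<in> {0<..<N}" for x
    using W01'[OF that] by (force simp: V_def)
  have r: "r = 1 + k"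
    using VV[of 0] unfolding conv0[of V, OF Vsym] split[of "\<lambda>x. (V x)\<^sup>2"] by (simp add: V0 k_def)
  have "sum V {0<..<N} = - k"
    unfolding k_def sum_negf[symmetric] using V01 by (intro sum.cong) auto
  hence "sum V {0..<N} = 1 - k" by (simp add: split V0)
  moreover have "(sum V {0..<N})\<^sup>2 = r * sum V {0..<N}"
    using total[OF V] by (simp add: VV sum_distrib_left)
  ultimately have "k = 1 \<or> k = 0" using r by (auto simp: power2_eq_square)
  moreover have "even k" unfolding k_def
  proof (rule even_sum_of_involution[where \<sigma> = "\<lambda>h. N - h"])
    have "odd N" using p N by simp
    thus "N - x \<noteq> x" for x by presburger
    show "(V (N - x))\<^sup>2 = (V x)\<^sup>2" for x
      using Vsym[of "x"] is_periodD[OF V, of "- x"] by (simp add: add.commute)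
  qed auto
  ultimately have "k = 0" by auto
  hence z: "V x = 0" if "x \<in> {0<..<N}" for x
    using that unfolding k_def by (subst (asm) sum_nonneg_eq_0_iff) auto
  have "W x = 1" if "\<not> N dvd x" for x
    using z[OF mod_range[OF that]] is_period_mod[OF V, of x] by (simp add: V_def)
  thus ?thesis using r \<open>k = 0\<close> by simp
qed

lemma cconv_mult_modulus:
  assumes "N > 0" "is_period N f" "is_period N g"
  shows "cconv (int k * N) f g x = int k * cconv N f g x"
proof -
  have "is_period N (\<lambda>h. f h * g (x - h))"
    using is_periodD[OF assms(2)] is_periodD[OF is_period_comp_diff[OF assms(3)]]
    by (simp add: is_period_def)
  from sum_periodic_mult[OF assms(1) this] show ?thesis by (simp add: cconv_def)
qed

lemma cconv_add_left: "cconv m (\<lambda>x. f x + g x) u x = cconv m f u x + cconv m g u x"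
  by (simp add: cconv_def sum.distrib algebra_simps)

lemma cconv_add_right: "cconv m u (\<lambda>x. f x + g x) x = cconv m u f x + cconv m u g x"
  by (simp add: cconv_def sum.distrib algebra_simps)

text \<open>As \<open>W\<close> is even, convolving it with the reflected \<open>Y\<close> reflects
  its convolution with \<open>Y\<close>. A relation for \<open>Y\<close> thus becomes one for
  \<open>W\<close> alone.\<close>

lemma cconv_symmetrization_square:
  assumes m: "m > 0" and Y: "is_period m Y"
    and W: "\<And>x. W x = Y x + Y (- x)"
  shows "cconv m W W x = cconv m Y W x + cconv m Y W (- x)"
proof -
  have pW: "is_period m W" and pY': "is_period m (\<lambda>x. Y (- x))"
    using is_periodD[OF Y] is_periodD[OF is_period_comp_diff[OF Y, of 0]] by (simp_all add: W is_period_def)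
  have sym: "(\<lambda>x. W (- x)) = W" by (auto simp: W)
  have "W = (\<lambda>x. Y x + Y (- x))" by (auto simp: W)
  hence "cconv m W W x = cconv m Y W x + cconv m (\<lambda>x. Y (- x)) W x"
    by (metis cconv_add_left)
  also have "cconv m (\<lambda>x. Y (- x)) W x = cconv m Y W (- x)"
    using cconv_reflect[OF m Y pW, of x] by (simp only: sym)
  finally show ?thesis .
qed

text \<open>Symmetrizing \<open>quad\<close> gives a quadratic relation for \<open>W\<close>, whose
  points of value 2 are its periods and form the subgroup of multiples of some
  \<open>p ^ \<gamma>\<close>. The relation is then carried to the quotient and classified there;
  \<open>nonsym\<close> supplies a point of value 1.\<close>

lemma symmetrization_classification:
  fixes Y W :: "int \<Rightarrow> int" and p \<alpha> :: nat
  assumes p: "prime p" "odd p" and m: "m = int p ^ \<alpha>"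
    and Y: "is_period m Y" and Y01: "\<And>x. Y x \<in> {0, 1}" and Y0: "Y 0 = 1"
    and W: "\<And>x. W x = Y x + Y (- x)"
    and nonsym: "\<exists>x. Y (- x) \<noteq> Y x"
    and quad: "\<And>x. cconv m Y W x = r * Y x + c"
  shows "\<exists>\<gamma>. 1 \<le> \<gamma> \<and> \<gamma> \<le> \<alpha> \<and> is_period (int p ^ \<gamma>) Y \<and>
    (\<forall>x. W x = (if int p ^ \<gamma> dvd x then 2 else 1)) \<and> r = int p ^ (\<alpha> - \<gamma>)"
proof -
  have mpos: "m > 0" using m prime_gt_0_nat[OF p(1)] by simp
  have pW: "is_period m W"
    using is_periodD[OF Y] is_periodD[OF is_period_comp_diff[OF Y, of 0]] by (simp add: W is_period_def)
  have sym: "W (- x) = W x" for x by (simp add: W)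
  have range: "W x \<in> {0, 1, 2}" for x using Y01[of x] Y01[of "- x"] by (auto simp: W)
  have W0: "W 0 = 2" by (simp add: W Y0)
  have WW: "cconv m W W x = r * W x + 2 * c" for x
    unfolding cconv_symmetrization_square[OF mpos Y W]
    by (simp add: quad W algebra_simps)
  have period: "W x = 2 \<longleftrightarrow> is_period x W" for x
  proof
    assume "W x = 2"
    hence "cconv m W W x = cconv m W W 0" by (simp add: WW W0)
    thus "is_period x W" by (rule period_of_cconv_self[OF mpos pW sym])
  next
    assume "is_period x W"
    from is_periodD[OF this, of 0] show "W x = 2" by (simp add: W0)
  qed
  have "\<exists>\<gamma>\<le>\<alpha>. {x. is_period x W} = {x. int p ^ \<gamma> dvd x}"
    by (rule int_subgroup_prime_power[OF p(1)]) (use pW m is_period_diff in auto)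
  then obtain \<gamma> where \<gamma>: "\<gamma> \<le> \<alpha>" "\<And>x. is_period x W \<longleftrightarrow> int p ^ \<gamma> dvd x" by blast
  define N where "N = int p ^ \<gamma>"
  have Npos: "N > 0" using prime_gt_0_nat[OF p(1)] by (simp add: N_def)
  have two: "W x = 2 \<longleftrightarrow> N dvd x" for x by (simp add: period \<gamma>(2) N_def)
  have NW: "is_period N W" by (simp add: \<gamma>(2) N_def)
  obtain x1 where x1: "W x1 = 1"
  proof -
    from nonsym obtain x where "Y (- x) \<noteq> Y x" by blast
    hence "W x = 1" using Y01[of x] Y01[of "- x"] by (auto simp: W)
    thus ?thesis by (rule that)
  qed
  have \<gamma>1: "\<gamma> \<ge> 1"
  proof (rule ccontr)
    assume "\<not> \<gamma> \<ge> 1"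
    hence "\<gamma> = 0" by simp
    hence "W x1 = 2" by (simp add: two N_def)
    thus False using x1 by simp
  qed
  define k where "k = p ^ (\<alpha> - \<gamma>)"
  have kpos: "int k > 0" using prime_gt_0_nat[OF p(1)] by (simp add: k_def)
  have mk: "m = int k * N" using \<gamma>(1) by (simp add: m k_def N_def flip: power_add)
  have kWW: "int k * cconv N W W x = r * W x + 2 * c" for x
    using cconv_mult_modulus[OF Npos NW NW, of k x] WW[of x] by (simp add: mk)
  \<comment> \<open>\<open>W\<close> is 2 at 0 and 1 at \<open>x1\<close>, so the two values of the
    relation differ by exactly \<open>r\<close>. Hence \<open>k\<close> divides \<open>r\<close>,
    then also \<open>2 * c\<close>, and can be cancelled.\<close>
  have "r = int k * (cconv N W W 0 - cconv N W W x1)"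
    using kWW[of 0] kWW[of x1] W0 x1 by (simp add: algebra_simps)
  then obtain r' where r': "r = int k * r'" by blast
  have "2 * c = int k * (cconv N W W x1 - r')" using kWW[of x1] x1 by (simp add: algebra_simps r')
  then obtain c' where c': "2 * c = int k * c'" by blast
  have "int k * cconv N W W x = int k * (r' * W x + c')" for x
    using kWW[of x] by (simp only: r' c' distrib_left mult.assoc)
  hence "cconv N W W x = r' * W x + c'" for x using kpos by (metis mult_cancel_left order_less_irrefl)
  from quadratic_weight_classification[OF p \<gamma>1 N_def NW sym range two _ this] x1
  have fin: "\<And>x. \<not> N dvd x \<Longrightarrow> W x = 1" "r' = 1" by auto
  \<comment> \<open>The left side of \<open>quad\<close> inherits the period \<open>N\<close> from
    \<open>W\<close>, and \<open>r = k\<close> is nonzero.\<close>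
  have "is_period N Y"
    unfolding is_period_def
  proof
    fix x
    have "r * Y (x + N) + c = r * Y x + c"
      using is_periodD[OF is_period_cconv[OF NW, of m Y], of x] by (simp add: quad)
    thus "Y (x + N) = Y x" using kpos r' fin(2) by simp
  qed
  thus ?thesis using \<gamma>1 \<gamma>(1) fin two r' by (intro exI[of _ \<gamma>]) (auto simp: N_def k_def)
qed

section \<open>Subgroup indicators and the two convolution equations\<close>

text \<open>For \<open>b\<close> dividing \<open>m\<close> this is the indicator of the subgroup
  generated by \<open>b\<close> modulo \<open>m\<close>; \<open>dvd_ind m\<close> is the point mass
  at 0.\<close>

abbreviation dvd_ind :: "int \<Rightarrow> int \<Rightarrow> int" where
  "dvd_ind b x \<equiv> (if b dvd x then 1 else 0)"

lemma is_period_dvd_ind: "b dvd m \<Longrightarrow> is_period m (dvd_ind b)"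
  by (auto simp: is_period_def dvd_add_left_iff)

lemma cconv_diff_left: "cconv m (\<lambda>x. f x - g x) u x = cconv m f u x - cconv m g u x"
  by (simp add: cconv_def sum_subtractf algebra_simps)

lemma cconv_diff_right: "cconv m u (\<lambda>x. f x - g x) x = cconv m u f x - cconv m u g x"
  by (simp add: cconv_def sum_subtractf algebra_simps)

text \<open>A \<open>b\<close>-periodic function is constant on cosets of the subgroup, so its
  indicator acts as a scalar, the order \<open>m div b\<close>.\<close>

lemma cconv_dvd_ind:
  assumes "b > 0" "b dvd m" "m > 0" "is_period b f"
  shows "cconv m (dvd_ind b) f x = (m div b) * f x"
proof -
  have "cconv m (dvd_ind b) f x = (\<Sum>h\<in>{0..<m}. dvd_ind b h * f x)"
    unfolding cconv_def by (intro sum.cong refl) (auto intro!: is_period_eqI[OF assms(4)])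
  also have "\<dots> = (m div b) * f x"
    using sum_if_dvd[OF assms(1,2,3)] by (simp only: flip: sum_distrib_right)
  finally show ?thesis .
qed

text \<open>If \<open>E x = E y = 1\<close>, symmetry and the term \<open>h = x\<close> make
  \<open>E * E\<close> positive at \<open>x - y\<close>. Away from 0 the relation then forbids
  \<open>E (x - y) = 0\<close>, so the support is closed under differences.\<close>

lemma subgroup_indicator_of_cconv_self:
  fixes E :: "int \<Rightarrow> int" and p \<alpha> :: nat
  assumes p: "prime p" and m: "m = int p ^ \<alpha>"
    and pE: "is_period m E" and E01: "\<And>x. E x \<in> {0, 1}" and E0: "E 0 = 1"
    and sym: "\<And>x. E (- x) = E x"
    and EE: "\<And>x. cconv m E E x = d * dvd_ind m x - c * E x"
  shows "\<exists>\<beta>\<le>\<alpha>. E = dvd_ind (int p ^ \<beta>)"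
proof -
  have mpos: "m > 0" using m prime_gt_0_nat[OF p] by simp
  have nonneg: "E x \<ge> 0" for x using E01[of x] by auto
  have "\<exists>\<beta>\<le>\<alpha>. {x. E x = 1} = {x. int p ^ \<beta> dvd x}"
  proof (rule int_subgroup_prime_power[OF p])
    show "int p ^ \<alpha> \<in> {x. E x = 1}" using is_periodD[OF pE, of 0] by (simp add: E0 m)
    fix x y assume "x \<in> {x. E x = 1}" "y \<in> {x. E x = 1}"
    hence xy: "E x = 1" "E (- y) = 1" using sym by auto
    have "1 = E (x mod m) * E (x - y - x mod m)"
    proof -
      have "E (x - y - x mod m) = E (- y)"
        by (rule is_period_eqI[OF pE]) (simp add: minus_mod_eq_div_mult)
      thus ?thesis using is_period_mod[OF pE, of x] xy by simp
    qed
    also have "\<dots> \<le> cconv m E E (x - y)"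
      unfolding cconv_def using mpos nonneg
      by (intro member_le_sum[of "x mod m" _ "\<lambda>h. E h * E (x - y - h)"]) auto
    finally have pos: "cconv m E E (x - y) \<ge> 1" .
    show "x - y \<in> {x. E x = 1}"
    proof (cases "m dvd x - y")
      case True
      then show ?thesis using is_period_eqI[OF pE, of "x - y" 0] by (simp add: E0)
    next
      case False
      then show ?thesis using pos E01[of "x - y"] by (auto simp: EE)
    qed
  qed
  then obtain \<beta> where \<beta>: "\<beta> \<le> \<alpha>" "\<And>x. E x = 1 \<longleftrightarrow> int p ^ \<beta> dvd x" by blast
  have "E x = dvd_ind (int p ^ \<beta>) x" for x using \<beta>(2)[of x] E01[of x] by auto
  thus ?thesis using \<beta>(1) by blast
qed

text \<open>Eliminating \<open>X = Y - E\<close> isolates \<open>E * E\<close>, so \<open>E\<close>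
  is a subgroup indicator. Once \<open>Y\<close> is known to be periodic along that subgroup,
  \<open>E\<close> acts on \<open>Y\<close> as a scalar and the second equation takes the form
  needed by \<open>symmetrization_classification\<close>.\<close>

lemma dihedral_equations_imp_classification:
  fixes X Y E :: "int \<Rightarrow> int" and p \<alpha> :: nat
  assumes p: "prime p" "odd p" and m: "m = int p ^ \<alpha>"
    and pX: "is_period m X" and X01: "\<And>x. X x \<in> {0, 1}" and X0: "X 0 = 0"
    and pY: "is_period m Y" and Y01: "\<And>x. Y x \<in> {0, 1}" and Y0: "Y 0 = 1"
    and E: "\<And>x. E x = Y x - X x" and E01: "\<And>x. E x \<in> {0, 1}" and Esym: "\<And>x. E (- x) = E x"
    and nonsym: "\<exists>x. X (- x) \<noteq> X x"
    and eq1: "\<And>x. cconv m X X x + cconv m Y (\<lambda>x. Y (- x)) x =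
      t * dvd_ind m x + l * X x + \<mu> * (1 - dvd_ind m x - X x)"
    and eq2: "\<And>x. cconv m X Y x + cconv m Y (\<lambda>x. X (- x)) x = l * Y x + \<mu> * (1 - Y x)"
  shows "\<exists>\<gamma>. 1 \<le> \<gamma> \<and> \<gamma> \<le> \<alpha> \<and> is_period (int p ^ \<gamma>) Y \<and>
    (\<forall>x. Y x + Y (- x) = (if int p ^ \<gamma> dvd x then 2 else 1)) \<and>
    (E = dvd_ind m \<or> E = dvd_ind (int p ^ \<gamma>))"
proof -
  define W where "W x = Y x + Y (- x)" for x
  define c where "c = l - \<mu>"
  have mpos: "m > 0" using m prime_gt_0_nat[OF p(1)] by simp
  have pE: "is_period m E" using pX pY by (simp add: E is_period_def)
  have E0: "E 0 = 1" by (simp add: E X0 Y0)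
  have X: "X = (\<lambda>x. Y x - E x)" by (auto simp: E)
  have pW: "is_period m W"
    using is_periodD[OF pY] is_periodD[OF is_period_comp_diff[OF pY, of 0]]
    by (simp add: W_def is_period_def)
  have Wsym: "W (- x) = W x" for x by (simp add: W_def)
  have Ynonsym: "\<exists>x. Y (- x) \<noteq> Y x" using nonsym by (auto simp: X Esym)
  have YE: "cconv m Y E x = cconv m E Y x" for x by (rule cconv_comm[OF mpos pY pE])
  have W': "cconv m Y W x = cconv m Y Y x + cconv m Y (\<lambda>x. Y (- x)) x" for x
    unfolding W_def by (rule cconv_add_right)
  have eq2': "cconv m Y W x = 2 * cconv m E Y x + c * Y x + \<mu>" for x
  proof -
    have "cconv m X Y x = cconv m Y Y x - cconv m E Y x"
      unfolding X by (rule cconv_diff_left)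
    moreover have "cconv m Y (\<lambda>x. X (- x)) x = cconv m Y (\<lambda>x. Y (- x)) x - cconv m E Y x"
      unfolding X by (simp add: cconv_diff_right Esym YE)
    ultimately show ?thesis using eq2[of x] W'[of x] by (simp add: c_def algebra_simps)
  qed
  \<comment> \<open>After substitution \<open>eq1\<close> contains \<open>Y * W - 2 E * Y\<close>,
    which \<open>eq2'\<close> evaluates; only \<open>E * E\<close> remains.\<close>
  have EE: "cconv m E E x = (t - \<mu>) * dvd_ind m x - c * E x" for x
  proof -
    have "cconv m X X x = cconv m Y Y x - 2 * cconv m E Y x + cconv m E E x"
      unfolding X by (simp add: cconv_diff_right cconv_diff_left YE)
    hence "cconv m Y W x - 2 * cconv m E Y x + cconv m E E x =
        t * dvd_ind m x + l * X x + \<mu> * (1 - dvd_ind m x - X x)"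
      using eq1[of x] W'[of x] by linarith
    thus ?thesis unfolding eq2' by (simp only: E[symmetric] c_def) (simp add: E algebra_simps)
  qed
  obtain \<beta> where \<beta>: "\<beta> \<le> \<alpha>" "E = dvd_ind (int p ^ \<beta>)"
    using subgroup_indicator_of_cconv_self[OF p(1) m pE E01 E0 Esym EE] by blast
  define b where "b = int p ^ \<beta>"
  have b: "b > 0" "b dvd m" "E = dvd_ind b"
    using prime_gt_0_nat[OF p(1)] \<beta> by (simp_all add: b_def m le_imp_power_dvd)
  have classify: "\<exists>\<gamma>. 1 \<le> \<gamma> \<and> \<gamma> \<le> \<alpha> \<and> is_period (int p ^ \<gamma>) Y \<and>
      (\<forall>x. W x = (if int p ^ \<gamma> dvd x then 2 else 1)) \<and> r = int p ^ (\<alpha> - \<gamma>)"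
    if "\<And>x. cconv m Y W x = r * Y x + \<mu>" for r
    by (rule symmetrization_classification[OF p m pY Y01 Y0 W_def Ynonsym that])
  show ?thesis
  proof (cases "\<beta> = \<alpha>")
    case True
    hence "E = dvd_ind m" using b(3) by (simp add: b_def m)
    moreover from this have "cconv m E Y x = Y x" for x
      using cconv_dvd_ind[OF mpos _ mpos pY, of x] mpos by simp
    hence "cconv m Y W x = (2 + c) * Y x + \<mu>" for x by (simp add: eq2' algebra_simps)
    ultimately show ?thesis using classify unfolding W_def by blast
  next
    case False
    define k where "k = m div b"
    have kpos: "k > 0" using b mpos by (simp add: k_def pos_imp_zdiv_pos_iff zdvd_imp_le)
    have "\<not> m dvd b"
    proof -
      have "b < m" using False \<beta>(1) p prime_gt_1_nat[of p] by (simp add: b_def m power_strict_increasing)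
      thus ?thesis using b(1) zdvd_not_zless by blast
    qed
    moreover have "cconv m E E b = k" 
      using cconv_dvd_ind[OF b(1,2) mpos is_period_dvd_ind[of b b], of b] by (simp add: b(3) k_def)
    \<comment> \<open>At \<open>b\<close> the point mass vanishes while \<open>E\<close> is
      1.\<close>
    ultimately have c: "c = - k" using EE[of b] by (simp add: b(3))
    have W2: "W x = 2" if "b dvd x" for x
    proof -
      have "Y x = 1" if "b dvd x" for x
        using E[of x] X01[of x] Y01[of x] that by (auto simp: b(3))
      from this[OF that] this[of "- x"] that show ?thesis by (simp add: W_def)
    qed
    have "cconv m E W x = 2 * k" if "b dvd x" for x
    proof -
      have "cconv m E W x = (\<Sum>h\<in>{0..<m}. dvd_ind b h * 2)"
        unfolding cconv_def b(3) using that W2 by (intro sum.cong) auto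
      also have "\<dots> = (\<Sum>h\<in>{0..<m}. dvd_ind b h) * 2" by (rule sum_distrib_right[symmetric])
      also have "\<dots> = 2 * k" unfolding sum_if_dvd[OF b(1,2) mpos] by (simp add: k_def)
      finally show ?thesis .
    qed
    moreover have "cconv m W W x = 2 * cconv m E W x + c * W x + 2 * \<mu>" for x
    proof -
      have "cconv m E (\<lambda>x. Y (- x)) x = cconv m E Y (- x)"
        using cconv_reflect[OF mpos pE pY, of x] by (simp add: Esym)
      hence "cconv m E W x = cconv m E Y x + cconv m E Y (- x)"
        unfolding W_def cconv_add_right by simp
      thus ?thesis
        unfolding cconv_symmetrization_square[OF mpos pY W_def] eq2' by (simp add: W_def algebra_simps)
    qed
    \<comment> \<open>On the subgroup \<open>W\<close> is constantly 2 and \<open>E * W\<close>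
      constantly \<open>2 * k\<close>, so the formula for \<open>W * W\<close> cannot distinguish
      \<open>b\<close> from 0.\<close>
    ultimately have "cconv m W W b = cconv m W W 0" by (simp add: W2)
    hence bW: "is_period b W" by (rule period_of_cconv_self[OF mpos pW Wsym])
    have bE: "is_period b E" unfolding b(3) by (rule is_period_dvd_ind) simp
    have bY: "is_period b Y"
      unfolding is_period_def
    proof
      fix x
      have "cconv m E Y (x + b) = cconv m E Y x"
        using is_periodD[OF is_period_cconv[OF bE, of m Y], of x] by (simp only: YE)
      moreover have "cconv m Y W (x + b) = cconv m Y W x"
        by (rule is_periodD[OF is_period_cconv[OF bW]])
      \<comment> \<open>Every other term of \<open>eq2'\<close> has period \<open>b\<close>, and
        \<open>c = - k\<close> is nonzero.\<close>
      ultimately have "c * Y (x + b) = c * Y x" unfolding eq2' by simp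
      thus "Y (x + b) = Y x" using c kpos by simp
    qed
    have "cconv m E Y x = k * Y x" for x
      unfolding b(3) k_def by (rule cconv_dvd_ind[OF b(1,2) mpos bY])
    hence "cconv m Y W x = k * Y x + \<mu>" for x by (simp add: eq2' c)
    from classify[OF this] obtain \<gamma> where \<gamma>: "1 \<le> \<gamma>" "\<gamma> \<le> \<alpha>" "is_period (int p ^ \<gamma>) Y"
      "\<forall>x. W x = (if int p ^ \<gamma> dvd x then 2 else 1)" "k = int p ^ (\<alpha> - \<gamma>)" by blast
    \<comment> \<open>The scalar \<open>r\<close> is here the subgroup order \<open>k\<close>, which
      the classification expresses through \<open>\<gamma>\<close>; comparing exponents gives
      \<open>\<gamma> = \<beta>\<close>.\<close>
    have "k = int p ^ (\<alpha> - \<beta>)"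
      using \<beta>(1) prime_gt_0_nat[OF p(1)] by (simp add: k_def m b_def power_diff)
    hence "\<alpha> - \<gamma> = \<alpha> - \<beta>" using \<gamma>(5) prime_gt_1_nat[OF p(1)] by simp
    hence "\<gamma> = \<beta>" using \<gamma>(2) \<beta>(1) by simp
    thus ?thesis using \<gamma> \<beta>(2) unfolding W_def by blast
  qed
qed

text \<open>The reflected \<open>Y\<close> equals \<open>1 + dvd_ind N - Y\<close>, so every
  convolution reduces to \<open>Y * Y\<close>, which cancels, and to scalar actions of subgroup
  indicators. The parameter \<open>\<mu>\<close> is the size \<open>s\<close> of
  \<open>Y\<close>.\<close>

lemma classification_imp_dihedral_equations:
  fixes X Y E :: "int \<Rightarrow> int" and N m :: int
  assumes N: "N > 1" "odd N" "N dvd m" and m: "m > 0"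
    and pY: "is_period N Y"
    and W: "\<And>x. Y x + Y (- x) = (if N dvd x then 2 else 1)"
    and X: "X = (\<lambda>x. Y x - E x)" and E: "E = dvd_ind m \<or> E = dvd_ind N"
    and s: "s = sum Y {0..<m}"
  shows "\<exists>t l. 0 \<le> l \<and> 0 < t \<and> t < sum X {0..<m} + sum Y {0..<m} \<and>
    (\<forall>x. cconv m X X x + cconv m Y (\<lambda>x. Y (- x)) x =
      t * dvd_ind m x + l * X x + s * (1 - dvd_ind m x - X x)) \<and>
    (\<forall>x. cconv m X Y x + cconv m Y (\<lambda>x. X (- x)) x = l * Y x + s * (1 - Y x))"
proof -
  define k where "k = m div N"
  have k: "m = N * k" using N(3) by (simp add: k_def)
  have kpos: "k > 0" using k m N(1) by (simp add: zero_less_mult_iff)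
  have pmY: "is_period m Y" using is_period_dvd[OF pY N(3)] .
  obtain b where b: "E = dvd_ind b" "b = m \<or> b = N" using E by blast
  define q where "q = m div b"
  have b': "b > 0" "b dvd m" "N dvd b" using b(2) m N by auto
  have q: "(b = m \<and> q = 1) \<or> (b = N \<and> q = k)" using b(2) m by (auto simp: q_def k_def)
  have pb: "is_period b Y" by (rule is_period_dvd[OF pY b'(3)])
  have EY: "cconv m E Y x = q * Y x" for x
    unfolding b(1) q_def by (rule cconv_dvd_ind[OF b'(1,2) m pb])
  have EE: "cconv m E E x = q * E x" for x
    unfolding b(1) q_def by (rule cconv_dvd_ind[OF b'(1,2) m is_period_dvd_ind]) simp
  have YE: "cconv m Y E x = q * Y x" for x
    using cconv_comm[OF m pmY is_period_dvd_ind[OF b'(2)], of x] EY[of x] by (simp add: b(1))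
  have PY: "cconv m Y (dvd_ind N) x = k * Y x" for x
    using cconv_comm[OF m pmY is_period_dvd_ind[OF N(3)], of x]
      cconv_dvd_ind[OF _ N(3) m pY, of x] N(1) by (simp add: k_def)
  have refl: "Y (- x) = 1 + dvd_ind N x - Y x" for x
    using W[of x] by (cases "N dvd x") simp_all
  have YY': "cconv m Y (\<lambda>x. Y (- x)) x = s + k * Y x - cconv m Y Y x" for x
  proof -
    have "cconv m Y (\<lambda>x. Y (- x)) x = cconv m Y (\<lambda>x. 1 + dvd_ind N x) x - cconv m Y Y x"
      unfolding refl cconv_diff_right ..
    also have "cconv m Y (\<lambda>x. 1 + dvd_ind N x) x = cconv m Y (\<lambda>x. 1) x + k * Y x"
      unfolding cconv_add_right PY ..
    also have "cconv m Y (\<lambda>x. 1) x = s" by (simp add: cconv_def s)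
    finally show ?thesis .
  qed
  have 2: "2 * s = m + k"
  proof -
    have "sum (\<lambda>x. Y (- x)) {0..<m} = s"
      using sum_periodic_reflect[OF m pmY, of 0] by (simp add: s)
    hence "2 * s = (\<Sum>x\<in>{0..<m}. Y x + Y (- x))" by (simp add: sum.distrib s)
    also have "\<dots> = (\<Sum>x\<in>{0..<m}. 1 + dvd_ind N x)" by (intro sum.cong) (auto simp: W)
    also have "\<dots> = m + k" using sum_if_dvd[OF _ N(3) m] N(1) m by (simp add: sum.distrib k_def)
    finally show ?thesis .
  qed
  \<comment> \<open>With \<open>2 * s = m + k\<close> this gives \<open>k < s\<close>, the source of
    both \<open>0 \<le> l\<close> and the genuineness bounds on \<open>t\<close>.\<close>
  have "N \<ge> 3" using N(1,2) by presburger
  hence "3 * k \<le> m" using kpos unfolding k by (intro mult_right_mono) auto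
  hence sk: "k < s" using 2 kpos by linarith
  define l where "l = s + k - 2 * q"
  \<comment> \<open>The term \<open>q * E\<close> from \<open>X * X\<close> decides
    \<open>t\<close>: a point mass moves it from \<open>s\<close> to \<open>s + k - 1\<close>, while
    the indicator of the multiples of \<open>N\<close> is absorbed into the multiple of
    \<open>X\<close>.\<close>
  define t where "t = (if b = m then s + k - 1 else s)"
  have qt: "q * E x = (t - s) * dvd_ind m x - (k - 2 * q) * E x" for x
    using q m by (auto simp: t_def b(1) k_def)
  have "sum E {0..<m} = q" unfolding b(1) q_def using sum_if_dvd[OF b'(1,2) m] by simp
  hence XY: "sum X {0..<m} + sum Y {0..<m} = 2 * s - q" by (simp add: X sum_subtractf s)
  have "cconv m X X x + cconv m Y (\<lambda>x. Y (- x)) x =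
      t * dvd_ind m x + l * X x + s * (1 - dvd_ind m x - X x)" for x
  proof -
    have "cconv m X X x = cconv m Y Y x - 2 * q * Y x + q * E x"
      unfolding X by (simp add: cconv_diff_right cconv_diff_left YE EY EE)
    thus ?thesis unfolding YY' qt by (simp add: X l_def algebra_simps)
  qed
  moreover have "cconv m X Y x + cconv m Y (\<lambda>x. X (- x)) x = l * Y x + s * (1 - Y x)" for x
  proof -
    have "E (- x) = E x" for x by (simp add: b(1))
    hence "cconv m Y (\<lambda>x. X (- x)) x = s + k * Y x - cconv m Y Y x - q * Y x"
      unfolding X by (simp add: cconv_diff_right YE YY')
    moreover have "cconv m X Y x = cconv m Y Y x - q * Y x"
      unfolding X by (simp add: cconv_diff_left EY)
    ultimately show ?thesis by (simp add: l_def algebra_simps)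
  qed
  moreover have "0 \<le> l \<and> 0 < t \<and> t < 2 * s - q"
  proof (cases "b = m")
    case True
    hence "q = 1" using m by (simp add: q_def)
    then show ?thesis using sk kpos True by (simp add: l_def t_def)
  next
    case False
    hence "q = k" using q by auto
    then show ?thesis using sk kpos False by (simp add: l_def t_def)
  qed
  ultimately show ?thesis unfolding XY by blast
qed

section \<open>Cayley digraphs of dihedral groups\<close>

definition residue_ind :: "nat \<Rightarrow> int set \<Rightarrow> int \<Rightarrow> int" where
  "residue_ind n X x = (if x mod int n \<in> X then 1 else 0)"

lemma is_period_residue_ind: "is_period (int n) (residue_ind n X)"
  by (simp add: is_period_def residue_ind_def)

lemma residue_ind_01: "residue_ind n X x \<in> {0, 1}"
  by (simp add: residue_ind_def)

lemma pverts_Dih: "pverts (Dih n X Y) = {0..<int n} \<times> UNIV"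
  by (simp add: Dih_def Let_def cayley_digraph_def dihedral_group_def)

text \<open>A reflection is its own inverse and negates the exponent to its right. Hence rows of
  reflections depend on \<open>i - j\<close> and rows of rotations on \<open>j - i\<close>.\<close>

lemma adjacency_matrix_Dih:
  assumes n: "n > 0" and X: "X \<subseteq> {0..<int n}" and Y: "Y \<subseteq> {0..<int n}"
    and u: "(i, s) \<in> {0..<int n} \<times> UNIV" and v: "(j, t) \<in> {0..<int n} \<times> UNIV"
  shows "adjacency_matrix (Dih n X Y) (i, s) (j, t) =
    residue_ind n (if s = t then X else Y) (if s then i - j else j - i)"
proof -
  interpret group "dihedral_group n" by (rule dihedral_group_is_group[OF n])
  have inv: "inv\<^bsub>dihedral_group n\<^esub> (i, s) = (if s then i else (- i) mod int n, s)"
    by (rule inv_equality) (use n u in \<open>auto simp: dihedral_group_def mod_simps\<close>)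
  have mod_id: "x mod int n = x" if "x \<in> X \<or> x \<in> Y" for x
    using that X Y by auto
  have S1: "{dih_x n [^]\<^bsub>dihedral_group n\<^esub> i | i. i \<in> X} = X \<times> {False}"
    using mod_id by (force simp: dih_x_pow[OF n])
  have S2: "{dih_x n [^]\<^bsub>dihedral_group n\<^esub> j \<otimes>\<^bsub>dihedral_group n\<^esub> dih_a | j. j \<in> Y} = Y \<times> {True}"
  proof -
    have "dih_x n [^]\<^bsub>dihedral_group n\<^esub> j \<otimes>\<^bsub>dihedral_group n\<^esub> dih_a = (j mod int n, True)" for j
      by (simp add: dih_x_pow[OF n]) (simp add: dihedral_group_def dih_a_def)
    thus ?thesis using mod_id by force
  qed
  have "(i, s) \<in> carrier (dihedral_group n)" "(j, t) \<in> carrier (dihedral_group n)"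
    using u v by (simp_all add: dihedral_group_def)
  hence "((i, s), (j, t)) \<in> parcs (Dih n X Y) \<longleftrightarrow>
      inv\<^bsub>dihedral_group n\<^esub> (i, s) \<otimes>\<^bsub>dihedral_group n\<^esub> (j, t) \<in> X \<times> {False} \<union> Y \<times> {True}"
    unfolding Dih_def Let_def cayley_digraph_def S1 S2 by simp
  also have "\<dots> \<longleftrightarrow> (if s then i - j else j - i) mod int n \<in> (if s = t then X else Y)"
    unfolding inv by (auto simp: dihedral_group_def mod_simps)
  finally show ?thesis by (simp add: adjacency_matrix_def residue_ind_def)
qed

lemma sum_times_bool:
  "sum f (A \<times> (UNIV :: bool set)) = (\<Sum>k\<in>A. f (k, False)) + (\<Sum>k\<in>A. f (k, True))"
  by (simp add: sum.cartesian_product[of "\<lambda>k s. f (k, s)", symmetric, simplified] UNIV_bool sum.distrib add.commute)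

text \<open>Split the sum over rotations and reflections and substitute \<open>k - i\<close> or
  \<open>i - k\<close>. The sign in \<open>d\<close> makes both kinds of rows give the same
  convolutions, and the intermediate vertex in the other coset produces the reflected
  factor.\<close>

lemma mat_prod_Dih:
  fixes n :: nat and X Y :: "int set"
  assumes n: "n > 0" and X: "X \<subseteq> {0..<int n}" and Y: "Y \<subseteq> {0..<int n}"
    and u: "(i, s) \<in> {0..<int n} \<times> UNIV" and v: "(j, t) \<in> {0..<int n} \<times> UNIV"
  defines "V \<equiv> {0..<int n} \<times> UNIV" and "A \<equiv> adjacency_matrix (Dih n X Y)"
    and "d \<equiv> (if s then i - j else j - i)" and "X' \<equiv> residue_ind n X" and "Y' \<equiv> residue_ind n Y"
  shows "mat_prod V A A (i, s) (j, t) =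
      (if s = t then cconv (int n) X' X' d + cconv (int n) Y' (\<lambda>x. Y' (- x)) d
       else cconv (int n) X' Y' d + cconv (int n) Y' (\<lambda>x. X' (- x)) d)"
    and "mat_prod V A mat_J (i, s) (j, t) = sum X' {0..<int n} + sum Y' {0..<int n}"
    and "mat_prod V mat_J A (i, s) (j, t) = sum X' {0..<int n} + sum Y' {0..<int n}"
proof -
  have n': "int n > 0" using n by simp
  note per = is_period_residue_ind[of n]
  have A: "A (i', s') (j', t') = residue_ind n (if s' = t' then X else Y) (if s' then i' - j' else j' - i')"
    if "i' \<in> {0..<int n}" "j' \<in> {0..<int n}" for i' j' s' t'
    unfolding A_def using that by (intro adjacency_matrix_Dih[OF n X Y]) auto
  have ij: "i \<in> {0..<int n}" "j \<in> {0..<int n}" using u v by auto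
  have shift: "(\<Sum>k\<in>{0..<int n}. residue_ind n Z (k - i) * f (k - i)) =
      (\<Sum>k\<in>{0..<int n}. residue_ind n Z k * f k)" if "is_period (int n) f" for Z f
    using sum_periodic_shift[OF n', of "\<lambda>k. residue_ind n Z k * f k" i] that per[of Z]
    by (simp add: is_period_def)
  have reflect: "(\<Sum>k\<in>{0..<int n}. residue_ind n Z (i - k) * f (i - k)) =
      (\<Sum>k\<in>{0..<int n}. residue_ind n Z k * f k)" if "is_period (int n) f" for Z f
    using sum_periodic_reflect[OF n', of "\<lambda>k. residue_ind n Z k * f k" i] that per[of Z]
    by (simp add: is_period_def)
  have pd: "is_period (int n) (\<lambda>h. residue_ind n Z (d - h))" for Z
    by (rule is_period_comp_diff[OF per])
  have ps: "is_period (int n) (\<lambda>h. residue_ind n Z (- (d - h)))" for Z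
    using is_period_comp_shift[OF per, of Z d] by (simp add: algebra_simps)
  show "mat_prod V A A (i, s) (j, t) =
      (if s = t then cconv (int n) X' X' d + cconv (int n) Y' (\<lambda>x. Y' (- x)) d
       else cconv (int n) X' Y' d + cconv (int n) Y' (\<lambda>x. X' (- x)) d)"
  proof (cases s)
    case False
    let ?Z1 = "if t then Y else X" and ?Z2 = "if t then X else Y"
    have "mat_prod V A A (i, s) (j, t) =
        (\<Sum>k\<in>{0..<int n}. residue_ind n X (k - i) * residue_ind n ?Z1 (d - (k - i))) +
        (\<Sum>k\<in>{0..<int n}. residue_ind n Y (k - i) * residue_ind n ?Z2 (- (d - (k - i))))"
      unfolding mat_prod_def V_def sum_times_bool using False ij
      by (intro arg_cong2[where f = "(+)"] sum.cong refl) (auto simp: A d_def)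
    thus ?thesis
      unfolding shift[OF pd] shift[OF ps] using False by (simp add: cconv_def X'_def Y'_def)
  next
    case True
    let ?Z1 = "if t then Y else X" and ?Z2 = "if t then X else Y"
    have "mat_prod V A A (i, s) (j, t) =
        (\<Sum>k\<in>{0..<int n}. residue_ind n Y (i - k) * residue_ind n ?Z1 (- (d - (i - k)))) +
        (\<Sum>k\<in>{0..<int n}. residue_ind n X (i - k) * residue_ind n ?Z2 (d - (i - k)))"
      unfolding mat_prod_def V_def sum_times_bool using True ij
      by (intro arg_cong2[where f = "(+)"] sum.cong refl) (auto simp: A d_def)
    thus ?thesis
      unfolding reflect[OF pd] reflect[OF ps] using True by (simp add: cconv_def X'_def Y'_def)
  qed
  have s1: "(\<Sum>k\<in>{0..<int n}. residue_ind n Z (k - c)) = sum (residue_ind n Z) {0..<int n}"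
    and s2: "(\<Sum>k\<in>{0..<int n}. residue_ind n Z (c - k)) = sum (residue_ind n Z) {0..<int n}" for Z c
    by (rule sum_periodic_shift[OF n' per], rule sum_periodic_reflect[OF n' per])
  have row: "(\<Sum>k\<in>{0..<int n}. A (i, s) (k, b)) = sum (residue_ind n (if s = b then X else Y)) {0..<int n}" for b
  proof -
    have "(\<Sum>k\<in>{0..<int n}. A (i, s) (k, b)) =
        (\<Sum>k\<in>{0..<int n}. residue_ind n (if s = b then X else Y) (if s then i - k else k - i))"
      using ij by (intro sum.cong refl A)
    thus ?thesis by (cases s) (simp_all add: s1 s2)
  qed
  have col: "(\<Sum>k\<in>{0..<int n}. A (k, b) (j, t)) = sum (residue_ind n (if b = t then X else Y)) {0..<int n}" for b
  proof -
    have "(\<Sum>k\<in>{0..<int n}. A (k, b) (j, t)) =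
        (\<Sum>k\<in>{0..<int n}. residue_ind n (if b = t then X else Y) (if b then k - j else j - k))"
      using ij by (intro sum.cong refl A)
    thus ?thesis by (cases b) (simp_all add: s1 s2)
  qed
  show "mat_prod V A mat_J (i, s) (j, t) = sum X' {0..<int n} + sum Y' {0..<int n}"
    unfolding mat_prod_def V_def sum_times_bool mat_J_def X'_def Y'_def by (simp add: row)
  show "mat_prod V mat_J A (i, s) (j, t) = sum X' {0..<int n} + sum Y' {0..<int n}"
    unfolding mat_prod_def V_def sum_times_bool mat_J_def X'_def Y'_def by (simp add: col)
qed

text \<open>A loop would be a diagonal entry, which is \<open>residue_ind n X 0\<close>, and 0 is
  not in \<open>X\<close>.\<close>

lemma pair_digraph_Dih:
  assumes n: "n > 0" and X: "X \<subseteq> {0..<int n} - {0}" and Y: "Y \<subseteq> {0..<int n}"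
  shows "pair_digraph (Dih n X Y)"
proof -
  have X1: "X \<subseteq> {0..<int n}" using X by auto
  have arcs: "e \<in> parcs (Dih n X Y) \<Longrightarrow> fst e \<in> pverts (Dih n X Y) \<and> snd e \<in> pverts (Dih n X Y)" for e
    by (auto simp: Dih_def Let_def cayley_digraph_def)
  have fin: "finite (pverts (Dih n X Y))" by (simp add: pverts_Dih)
  have "parcs (Dih n X Y) \<subseteq> pverts (Dih n X Y) \<times> pverts (Dih n X Y)" using arcs by force
  hence fin': "finite (parcs (Dih n X Y))" by (rule finite_subset) (use fin in auto)
  have loop: "fst e \<noteq> snd e" if "e \<in> parcs (Dih n X Y)" for e
  proof
    assume eq: "fst e = snd e"
    obtain i s where e: "fst e = (i, s)" by force
    hence "e = ((i, s), (i, s))" using eq e by (metis prod.collapse)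
    hence "adjacency_matrix (Dih n X Y) (i, s) (i, s) = 1" using that by (simp add: adjacency_matrix_def)
    moreover have "(i, s) \<in> {0..<int n} \<times> UNIV" using arcs[OF that] e by (simp add: pverts_Dih)
    ultimately show False
      using adjacency_matrix_Dih[OF n X1 Y, of i s i s] X by (auto simp: residue_ind_def split: if_splits)
  qed
  show ?thesis by unfold_locales (use arcs fin fin' loop in auto)
qed

text \<open>An entry of the matrix equation depends only on \<open>d\<close> and on whether the two
  vertices lie in the same coset, so two convolution identities express it completely.\<close>

lemma dsrg_Dih_iff:
  fixes n :: nat and X Y :: "int set"
  assumes n: "n > 0" and X: "X \<subseteq> {0..<int n} - {0}" and Y: "Y \<subseteq> {0..<int n}"
  defines "X' \<equiv> residue_ind n X" and "Y' \<equiv> residue_ind n Y"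
  shows "dsrg (Dih n X Y) v k \<mu> l t \<longleftrightarrow>
    v = 2 * n \<and> int k = sum X' {0..<int n} + sum Y' {0..<int n} \<and> 0 < t \<and> t < k \<and>
    (\<forall>x. cconv (int n) X' X' x + cconv (int n) Y' (\<lambda>x. Y' (- x)) x =
      int t * dvd_ind (int n) x + int l * X' x + int \<mu> * (1 - dvd_ind (int n) x - X' x)) \<and>
    (\<forall>x. cconv (int n) X' Y' x + cconv (int n) Y' (\<lambda>x. X' (- x)) x =
      int l * Y' x + int \<mu> * (1 - Y' x))"
    (is "?L \<longleftrightarrow> ?R")
proof -
  let ?V = "{0..<int n} \<times> (UNIV :: bool set)"
  have X1: "X \<subseteq> {0..<int n}" using X by auto
  note mp = mat_prod_Dih[OF n X1 Y] and adj = adjacency_matrix_Dih[OF n X1 Y]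
  have n': "int n > 0" using n by simp
  have card: "card (pverts (Dih n X Y)) = 2 * n"
    by (simp add: pverts_Dih card_cartesian_product)
  have pX: "is_period (int n) X'" and pY: "is_period (int n) Y'"
    by (simp_all add: X'_def Y'_def is_period_residue_ind)
  show ?thesis
  proof
    assume L: ?L
    have D: "mat_prod ?V (adjacency_matrix (Dih n X Y)) mat_J u w = int k * mat_J u w \<and>
        mat_prod ?V (adjacency_matrix (Dih n X Y)) (adjacency_matrix (Dih n X Y)) u w =
          int t * mat_I u w + int l * adjacency_matrix (Dih n X Y) u w +
          int \<mu> * (mat_J u w - mat_I u w - adjacency_matrix (Dih n X Y) u w)" if "u \<in> ?V" "w \<in> ?V" for u w
      using L that unfolding dsrg_def Let_def pverts_Dih by blast
    \<comment> \<open>The row of the identity already meets every \<open>d\<close> in both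
      cosets.\<close>
    have z: "(0, False) \<in> ?V" using n by simp
    have "int k = sum X' {0..<int n} + sum Y' {0..<int n}"
      using D[OF z z] mp(2)[OF z z] by (simp add: mat_J_def X'_def Y'_def)
    moreover have "cconv (int n) X' X' x + cconv (int n) Y' (\<lambda>x. Y' (- x)) x =
        int t * dvd_ind (int n) x + int l * X' x + int \<mu> * (1 - dvd_ind (int n) x - X' x)" for x
    proof -
      have x: "(x mod int n, False) \<in> ?V" using n by simp
      have "cconv (int n) X' X' (x mod int n) + cconv (int n) Y' (\<lambda>x. Y' (- x)) (x mod int n) =
          int t * dvd_ind (int n) x + int l * X' (x mod int n) +
          int \<mu> * (1 - dvd_ind (int n) x - X' (x mod int n))"
        using D[OF z x] mp(1)[OF z x] adj[OF z x]
        by (auto simp: mat_J_def mat_I_def X'_def Y'_def dvd_eq_mod_eq_0)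
      thus ?thesis
        using is_period_mod[OF is_period_cconv[OF pX, of "int n" X'], of x]
          is_period_mod[OF is_period_cconv[OF is_period_comp_diff[OF pY, of 0], of "int n" Y'], of x]
          is_period_mod[OF pX, of x] by simp
    qed
    moreover have "cconv (int n) X' Y' x + cconv (int n) Y' (\<lambda>x. X' (- x)) x =
        int l * Y' x + int \<mu> * (1 - Y' x)" for x
    proof -
      have x: "(x mod int n, True) \<in> ?V" using n by simp
      have "cconv (int n) X' Y' (x mod int n) + cconv (int n) Y' (\<lambda>x. X' (- x)) (x mod int n) =
          int l * Y' (x mod int n) + int \<mu> * (1 - Y' (x mod int n))"
        using D[OF z x] mp(1)[OF z x] adj[OF z x]
        by (auto simp: mat_J_def mat_I_def X'_def Y'_def)
      thus ?thesis
        using is_period_mod[OF is_period_cconv[OF pY, of "int n" X'], of x]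
          is_period_mod[OF is_period_cconv[OF is_period_comp_diff[OF pX, of 0], of "int n" Y'], of x]
          is_period_mod[OF pY, of x] by simp
    qed
    ultimately show ?R using L card by (simp add: dsrg_def)
  next
    assume R: ?R
    have "mat_prod ?V (adjacency_matrix (Dih n X Y)) mat_J u w = int k * mat_J u w \<and>
        mat_prod ?V mat_J (adjacency_matrix (Dih n X Y)) u w = int k * mat_J u w \<and>
        mat_prod ?V (adjacency_matrix (Dih n X Y)) (adjacency_matrix (Dih n X Y)) u w =
          int t * mat_I u w + int l * adjacency_matrix (Dih n X Y) u w +
          int \<mu> * (mat_J u w - mat_I u w - adjacency_matrix (Dih n X Y) u w)"
      if "u \<in> ?V" "w \<in> ?V" for u w
    proof -
      obtain i s j t' where uw: "u = (i, s)" "w = (j, t')" by (metis prod.collapse)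
      note uV = that(1)[unfolded uw] and wV = that(2)[unfolded uw]
      define d where "d = (if s then i - j else j - i)"
      have "mat_I u w = (if s = t' then dvd_ind (int n) d else 0)"
      proof -
        have "int n dvd d \<longleftrightarrow> i = j"
          using uV wV by (auto simp: d_def simp flip: mod_eq_dvd_iff)
        thus ?thesis by (auto simp: mat_I_def uw)
      qed
      thus ?thesis
        using R unfolding uw mp(1,2,3)[OF uV wV] adj[OF uV wV]
          d_def[symmetric] X'_def[symmetric] Y'_def[symmetric]
        by (cases "s = t'") (simp_all add: mat_J_def flip: X'_def Y'_def)
    qed
    thus ?L using R card pair_digraph_Dih[OF n X Y] by (simp add: dsrg_def Let_def pverts_Dih)
  qed
qed

section \<open>Unit orbits, multisets of residues and genuineness\<close>

lemma carrier_residue_ring: "carrier (residue_ring m) = {0..<m}"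
  by (auto simp: residue_ring_def)

text \<open>A set is a union of orbits exactly when it is stable under the action. Letting
  \<open>u\<close> be any integer coprime to \<open>m\<close>, not only a residue, allows
  \<open>u = - 1\<close> directly.\<close>

lemma Union_unit_orbits_iff:
  assumes m: "m > 1" and S: "S \<subseteq> {0..<m}"
  shows "(\<exists>\<O>. \<O> \<subseteq> unit_orbits m \<and> S = \<Union>\<O>) \<longleftrightarrow>
    (\<forall>z\<in>S. \<forall>u. coprime u m \<longrightarrow> (u * z) mod m \<in> S)"
proof -
  interpret residues m "residue_ring m" using m by unfold_locales simp_all
  define orb where "orb z = {(u * z) mod m | u. 0 < u \<and> u < m \<and> coprime u m}" for z
  have orbits: "unit_orbits m = orb ` {0..<m}"
    by (auto simp: unit_orbits_def orbits_def orbit_def orb_def units_of_def res_units_eq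
        res_mult_eq carrier_residue_ring image_def)
  have unit_mod: "0 < u mod m \<and> u mod m < m \<and> coprime (u mod m) m" if "coprime u m" for u
  proof -
    have "u mod m \<noteq> 0"
    proof
      assume "u mod m = 0"
      hence "m dvd u" by (simp add: dvd_eq_mod_eq_0)
      hence "is_unit m" using that coprime_common_divisor[of u m m] by simp
      thus False using m by simp
    qed
    moreover have "u mod m \<ge> 0" "u mod m < m" using m by simp_all
    ultimately have "0 < u mod m" "u mod m < m" by linarith+
    thus ?thesis using that m by (simp add: coprime_mod_left_iff)
  qed
  show ?thesis
  proof
    assume "\<exists>\<O>. \<O> \<subseteq> unit_orbits m \<and> S = \<Union>\<O>"
    then obtain \<O> where \<O>: "\<O> \<subseteq> unit_orbits m" "S = \<Union>\<O>" by blast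
    show "\<forall>z\<in>S. \<forall>u. coprime u m \<longrightarrow> (u * z) mod m \<in> S"
    proof (intro ballI allI impI)
      fix z u assume z: "z \<in> S" and u: "coprime u m"
      then obtain w where w: "orb w \<in> \<O>" "z \<in> orb w" using \<O> orbits by auto
      then obtain u' where u': "z = (u' * w) mod m" "coprime u' m" by (auto simp: orb_def)
      have "(u * z) mod m = ((u * u') mod m * w) mod m"
        by (simp add: u'(1) mod_simps mult.assoc)
      moreover have "coprime (u * u') m" using u u'(2) by simp
      ultimately have "(u * z) mod m \<in> orb w"
        unfolding orb_def using unit_mod by blast
      thus "(u * z) mod m \<in> S" using w(1) \<O>(2) by blast
    qed
  next
    assume closed: "\<forall>z\<in>S. \<forall>u. coprime u m \<longrightarrow> (u * z) mod m \<in> S"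
    have "z \<in> orb z" if "z \<in> S" for z
      unfolding orb_def using that S m by (auto intro!: exI[of _ 1])
    moreover have "orb z \<subseteq> S" if "z \<in> S" for z using that closed by (auto simp: orb_def)
    ultimately have "S = \<Union>(orb ` S)" by blast
    moreover have "orb ` S \<subseteq> unit_orbits m" using S orbits by blast
    ultimately show "\<exists>\<O>. \<O> \<subseteq> unit_orbits m \<and> S = \<Union>\<O>" by blast
  qed
qed

text \<open>Compare multiplicities: negation is injective on residues, so \<open>z\<close> occurs in
  the negated multiset exactly when \<open>- z\<close> lies in \<open>H\<close>, and the added 0
  accounts for the value 2.\<close>

lemma mset_symmetrization_iff:
  fixes n :: nat and H :: "int set"
  assumes n: "n > 1" and H: "H \<subseteq> {0..<int n}"
  shows "mset_set H + image_mset (\<lambda>h. \<ominus>\<^bsub>residue_ring (int n)\<^esub> h) (mset_set H) =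
      mset_set (carrier (residue_ring (int n))) + {#0#} \<longleftrightarrow>
    (\<forall>x. residue_ind n H x + residue_ind n H (- x) = (if int n dvd x then 2 else 1))"
    (is "?A + ?B = ?C \<longleftrightarrow> ?R")
proof -
  interpret residues "int n" "residue_ring (int n)" using n by unfold_locales simp_all
  have neg: "\<ominus>\<^bsub>residue_ring (int n)\<^esub> h = (- h) mod int n" for h by (rule res_neg_eq)
  have finH: "finite H" using H finite_subset by blast
  have negneg: "(- ((- z) mod int n)) mod int n = z" if "z \<in> {0..<int n}" for z
    using that by (simp add: mod_minus_eq)
  have B: "?B = mset_set ((\<lambda>h. (- h) mod int n) ` H)"
    unfolding neg
  proof (rule image_mset_mset_set)
    show "inj_on (\<lambda>h. (- h) mod int n) H"
      by (rule inj_on_inverseI[where g = "\<lambda>h. (- h) mod int n"]) (use negneg H in blast)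
  qed
  have imH: "z \<in> (\<lambda>h. (- h) mod int n) ` H \<longleftrightarrow> (- z) mod int n \<in> H" if "z \<in> {0..<int n}" for z
  proof
    assume "z \<in> (\<lambda>h. (- h) mod int n) ` H"
    then obtain h where "h \<in> H" "z = (- h) mod int n" by blast
    thus "(- z) mod int n \<in> H" using negneg[of h] H by auto
  next
    assume "(- z) mod int n \<in> H"
    from imageI[OF this, of "\<lambda>h. (- h) mod int n"]
    show "z \<in> (\<lambda>h. (- h) mod int n) ` H" by (simp only: negneg[OF that])
  qed
  have imH': "(\<lambda>h. (- h) mod int n) ` H \<subseteq> {0..<int n}" using n by auto
  have count: "count (?A + ?B) z = count ?C z \<longleftrightarrow>
      residue_ind n H z + residue_ind n H (- z) = (if int n dvd z then 2 else 1)" if "z \<in> {0..<int n}" for z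
  proof -
    have "int (count (?A + ?B) z) = residue_ind n H z + residue_ind n H (- z)"
      using that finH imH[OF that] unfolding B by (simp add: count_mset_set' residue_ind_def)
    moreover have "int (count ?C z) = (if int n dvd z then 2 else 1)"
      using that zdvd_not_zless[of z "int n"] by (auto simp: count_mset_set' carrier_residue_ring)
    ultimately show ?thesis by (metis of_nat_eq_iff)
  qed
  have outside: "count (?A + ?B) z = count ?C z" if "z \<notin> {0..<int n}" for z
  proof -
    have "z \<notin> H" "z \<notin> (\<lambda>h. (- h) mod int n) ` H" using that H imH' by blast+
    moreover have "z \<noteq> 0" using that n by auto
    ultimately show ?thesis using that unfolding B by (simp add: count_mset_set' carrier_residue_ring)
  qed
  have "?A + ?B = ?C \<longleftrightarrow> (\<forall>z. count (?A + ?B) z = count ?C z)"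
    by (rule multiset_eq_iff)
  also have "\<dots> \<longleftrightarrow> (\<forall>z\<in>{0..<int n}. residue_ind n H z + residue_ind n H (- z) = (if int n dvd z then 2 else 1))"
    using count outside by blast
  also have "\<dots> \<longleftrightarrow> ?R"
  proof
    assume *: "\<forall>z\<in>{0..<int n}. residue_ind n H z + residue_ind n H (- z) = (if int n dvd z then 2 else 1)"
    show ?R
    proof
      fix x
      have "x mod int n \<in> {0..<int n}" using n by simp
      from *[rule_format, OF this]
      show "residue_ind n H x + residue_ind n H (- x) = (if int n dvd x then 2 else 1)"
        by (simp add: residue_ind_def mod_minus_eq dvd_eq_mod_eq_0)
    qed
  qed blast
  finally show ?thesis .
qed

lemma multiples_subgroup_eq:
  assumes "m > 0" "d dvd m" "d > 0"
  shows "multiples_subgroup d m = {z \<in> {0..<m}. d dvd z}"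
proof (intro equalityI subsetI)
  fix z assume "z \<in> multiples_subgroup d m"
  then show "z \<in> {z \<in> {0..<m}. d dvd z}"
    using assms by (auto simp: multiples_subgroup_def dvd_mod_iff)
next
  fix z assume z: "z \<in> {z \<in> {0..<m}. d dvd z}"
  then obtain y where y: "z = d * y" by auto
  have "0 \<le> y" using z y assms by (auto simp: zero_le_mult_iff)
  moreover from this have "1 * y \<le> d * y" using assms by (intro mult_right_mono) auto
  ultimately have "y \<in> {0..<m}" using z y by auto
  then show "z \<in> multiples_subgroup d m"
    unfolding multiples_subgroup_def carrier_residue_ring using z y by (auto intro!: exI[of _ y])
qed

text \<open>For symmetric \<open>X\<close> the left side of \<open>eq1\<close> counts the elements
  of \<open>X\<close> and \<open>Y\<close>, while the right side is \<open>t\<close>; this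
  contradicts \<open>t < k\<close>.\<close>

lemma nonsymmetric_of_genuine:
  fixes X Y :: "int \<Rightarrow> int"
  assumes X01: "\<And>x. X x \<in> {0, 1}" and Y01: "\<And>x. Y x \<in> {0, 1}"
    and X0: "X 0 = 0"
    and eq1: "cconv m X X 0 + cconv m Y (\<lambda>x. Y (- x)) 0 =
      t * dvd_ind m 0 + l * X 0 + \<mu> * (1 - dvd_ind m 0 - X 0)"
    and less: "t < sum X {0..<m} + sum Y {0..<m}"
  shows "\<exists>x. X (- x) \<noteq> X x"
proof (rule ccontr)
  assume "\<not> ?thesis"
  hence sym: "X (- x) = X x" for x by blast
  have "X h * X h = X h" "Y h * Y h = Y h" for h using X01[of h] Y01[of h] by auto
  hence "cconv m X X 0 = sum X {0..<m}" "cconv m Y (\<lambda>x. Y (- x)) 0 = sum Y {0..<m}"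
    by (simp_all only: cconv_def diff_0 minus_minus sym)
  thus False using eq1 less X0 by simp
qed

theorem theorem7p2:
  fixes p \<alpha> :: nat and X Y :: "int set"
  assumes "prime p" and "odd p" and "\<alpha> \<ge> 1"
    and "X \<subseteq> carrier (residue_ring (int p ^ \<alpha>)) - {0}"
    and "Y \<subseteq> carrier (residue_ring (int p ^ \<alpha>))"
    and "0 \<in> Y"
  shows "(is_dsrg (Dih (p ^ \<alpha>) X Y) \<and> X \<subset> Y \<and>
          (\<exists>\<O>. \<O> \<subseteq> unit_orbits (int p ^ \<alpha>) \<and> Y - X = \<Union>\<O>))
    \<longleftrightarrow>
         (\<exists>\<gamma> H. 1 \<le> \<gamma> \<and> \<gamma> \<le> \<alpha> \<and>
            H \<subseteq> carrier (residue_ring (int p ^ \<gamma>)) \<and>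
            mset_set H + image_mset (\<lambda>h. \<ominus>\<^bsub>residue_ring (int p ^ \<gamma>)\<^esub> h) (mset_set H)
              = mset_set (carrier (residue_ring (int p ^ \<gamma>))) + {#0#} \<and>
            Y = {y \<in> carrier (residue_ring (int p ^ \<alpha>)). psi p \<gamma> y \<in> H} \<and>
            (X = Y - {0} \<or>
             X = Y - multiples_subgroup (int p ^ \<gamma>) (int p ^ \<alpha>)))"
    (is "?L \<longleftrightarrow> ?R")
proof -
  define n where "n = p ^ \<alpha>"
  define m where "m = int n"
  define X' where "X' = residue_ind n X"
  define Y' where "Y' = residue_ind n Y"
  define E where "E x = Y' x - X' x" for x
  have m: "m = int p ^ \<alpha>" by (simp add: m_def n_def)
  have p1: "p > 1" using assms(1) by (rule prime_gt_1_nat)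
  have n1: "n > 1" using p1 assms(3) unfolding n_def by (intro one_less_power) auto
  have m1: "m > 1" using n1 by (simp add: m_def)
  have n0: "n > 0" using n1 by simp
  have X: "X \<subseteq> {0..<int n} - {0}" and Y: "Y \<subseteq> {0..<int n}"
    using assms(4,5) by (simp_all add: carrier_residue_ring n_def)
  have pX: "is_period m X'" and pY: "is_period m Y'"
    by (simp_all add: X'_def Y'_def m_def is_period_residue_ind)
  have X01: "X' x \<in> {0, 1}" and Y01: "Y' x \<in> {0, 1}" for x
    by (simp_all only: X'_def Y'_def residue_ind_01)
  have X0: "X' 0 = 0" using X by (auto simp: X'_def residue_ind_def)
  have Y0: "Y' 0 = 1" using assms(6) by (simp add: Y'_def residue_ind_def)
  have memX: "x \<in> X \<longleftrightarrow> X' x = 1" and memY: "x \<in> Y \<longleftrightarrow> Y' x = 1" if "x \<in> {0..<m}" for x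
    using that by (simp_all add: X'_def Y'_def residue_ind_def m_def)
  note dsrg_iff = dsrg_Dih_iff[OF n0 X Y, folded X'_def Y'_def m_def]
  have gamma: "int p ^ \<gamma> dvd m" "int p ^ \<gamma> > 1" "odd (int p ^ \<gamma>)" "p ^ \<gamma> > 1"
    "multiples_subgroup (int p ^ \<gamma>) m = {z \<in> {0..<m}. int p ^ \<gamma> dvd z}"
    if "1 \<le> \<gamma>" "\<gamma> \<le> \<alpha>" for \<gamma>
  proof -
    show dvd: "int p ^ \<gamma> dvd m" using that by (simp add: m le_imp_power_dvd)
    show gt: "int p ^ \<gamma> > 1" "p ^ \<gamma> > 1"
      using that p1 by (intro one_less_power; simp)+
    show "odd (int p ^ \<gamma>)" using assms(2) by simp
    show "multiples_subgroup (int p ^ \<gamma>) m = {z \<in> {0..<m}. int p ^ \<gamma> dvd z}"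
      using p1 m1 by (intro multiples_subgroup_eq dvd) auto
  qed
  show ?thesis
  proof
    assume L: ?L
    then obtain v k \<mu> l t where D: "dsrg (Dih n X Y) v k \<mu> l t"
      unfolding is_dsrg_def n_def by blast
    have k: "int k = sum X' {0..<m} + sum Y' {0..<m}" "t < k"
      and eq1: "\<And>x. cconv m X' X' x + cconv m Y' (\<lambda>x. Y' (- x)) x =
        int t * dvd_ind m x + int l * X' x + int \<mu> * (1 - dvd_ind m x - X' x)"
      and eq2: "\<And>x. cconv m X' Y' x + cconv m Y' (\<lambda>x. X' (- x)) x = int l * Y' x + int \<mu> * (1 - Y' x)"
      using D unfolding dsrg_iff by blast+
    have E01: "E x \<in> {0, 1}" for x
      using L by (auto simp: E_def X'_def Y'_def residue_ind_def)
    have E_iff: "E x = 1 \<longleftrightarrow> x mod m \<in> Y - X" for x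
      using L by (auto simp: E_def X'_def Y'_def residue_ind_def m_def)
    have "Y - X \<subseteq> {0..<m}" using Y by (auto simp: m_def)
    from Union_unit_orbits_iff[OF m1 this] L
    have closed: "(u * z) mod m \<in> Y - X" if "z \<in> Y - X" "coprime u m" for z u
      using that unfolding m by blast
    \<comment> \<open>Stability under the unit \<open>- 1\<close> makes \<open>E\<close>
      even.\<close>
    have "E (- x) = 1" if "E x = 1" for x
      using closed[of "x mod m" "- 1"] that by (simp add: E_iff mod_minus_eq)
    from this this[of "- _"] have Esym: "E (- x) = E x" for x
      using E01[of x] E01[of "- x"] by (metis insertE singletonD minus_minus)
    have nonsym: "\<exists>x. X' (- x) \<noteq> X' x"
      by (rule nonsymmetric_of_genuine[OF X01 Y01 X0 eq1]) (use k in linarith)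
    obtain \<gamma> where \<gamma>: "1 \<le> \<gamma>" "\<gamma> \<le> \<alpha>" and pN: "is_period (int p ^ \<gamma>) Y'"
      and W: "\<And>x. Y' x + Y' (- x) = (if int p ^ \<gamma> dvd x then 2 else 1)"
      and E: "E = dvd_ind m \<or> E = dvd_ind (int p ^ \<gamma>)"
      using dihedral_equations_imp_classification
        [OF assms(1,2) m pX X01 X0 pY Y01 Y0 E_def E01 Esym nonsym eq1 eq2] by blast
    define N where "N = p ^ \<gamma>"
    note g = gamma[OF \<gamma>]
    have iN: "int N = int p ^ \<gamma>" by (simp add: N_def)
    have Nm: "int N \<le> m" using g(1) m1 by (auto simp: iN intro: zdvd_imp_le)
    \<comment> \<open>Since \<open>Y'\<close> has period \<open>p ^ \<gamma>\<close>, the members of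
      \<open>Y\<close> in the first period are its whole image under \<open>psi\<close>.\<close>
    define H where "H = Y \<inter> {0..<int N}"
    have H: "residue_ind N H x = Y' x" for x
    proof -
      have "x mod int N \<in> {0..<int N}" using p1 by (simp add: iN)
      hence "x mod int N \<in> H \<longleftrightarrow> Y' (x mod int N) = 1"
        using memY[of "x mod int N"] Nm by (auto simp: H_def)
      thus ?thesis using is_period_mod[OF pN, of x] Y01[of x] by (auto simp: residue_ind_def iN)
    qed
    have HN: "H \<subseteq> {0..<int N}" by (auto simp: H_def)
    have "mset_set H + image_mset (\<lambda>h. \<ominus>\<^bsub>residue_ring (int N)\<^esub> h) (mset_set H) =
        mset_set (carrier (residue_ring (int N))) + {#0#}"
      using g(4) W by (subst mset_symmetrization_iff[OF _ HN]) (simp_all add: N_def[symmetric] H iN)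
    moreover have "Y = {y \<in> {0..<m}. psi p \<gamma> y \<in> H}"
    proof -
      have "psi p \<gamma> y \<in> H \<longleftrightarrow> Y' y = 1" for y
        using H[of y] by (auto simp: psi_def residue_ind_def iN split: if_splits)
      thus ?thesis using Y memY by (auto simp: m_def)
    qed
    moreover have "X = Y - {0} \<or> X = Y - multiples_subgroup (int N) m"
    proof -
      have XE: "x \<in> X \<longleftrightarrow> x \<in> Y \<and> E x = 0" if "x \<in> {0..<m}" for x
        using memX[OF that] memY[OF that] X01[of x] Y01[of x] E01[of x] by (auto simp: E_def)
      have sub: "x \<in> {0..<m}" if "x \<in> X \<or> x \<in> Y" for x using that X Y by (auto simp: m_def)
      have dvd0: "m dvd x \<longleftrightarrow> x = 0" if "x \<in> {0..<m}" for x
        using that zdvd_not_zless[of x m] by (cases "x = 0") auto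
      from E show ?thesis
      proof
        assume Em: "E = dvd_ind m"
        have "x \<in> X \<longleftrightarrow> x \<in> Y - {0}" for x
        proof (cases "x \<in> {0..<m}")
          case True
          then show ?thesis using XE[OF True] dvd0[OF True] by (simp add: Em)
        qed (use sub in blast)
        thus ?thesis by blast
      next
        assume EN: "E = dvd_ind (int p ^ \<gamma>)"
        have "x \<in> X \<longleftrightarrow> x \<in> Y - multiples_subgroup (int N) m" for x
        proof (cases "x \<in> {0..<m}")
          case True
          then show ?thesis unfolding iN g(5) using XE[OF True] by (simp add: EN)
        qed (use sub in blast)
        thus ?thesis by blast
      qed
    qed
    ultimately show ?R
      using \<gamma> HN unfolding carrier_residue_ring iN m by blast
  next
    assume ?R
    then obtain \<gamma> H where \<gamma>: "1 \<le> \<gamma>" "\<gamma> \<le> \<alpha>" and HN: "H \<subseteq> {0..<int p ^ \<gamma>}"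
      and ms: "mset_set H + image_mset (\<lambda>h. \<ominus>\<^bsub>residue_ring (int p ^ \<gamma>)\<^esub> h) (mset_set H)
              = mset_set (carrier (residue_ring (int p ^ \<gamma>))) + {#0#}"
      and YH: "Y = {y \<in> {0..<m}. psi p \<gamma> y \<in> H}"
      and XY: "X = Y - {0} \<or> X = Y - multiples_subgroup (int p ^ \<gamma>) m"
      unfolding carrier_residue_ring m by blast
    define N where "N = p ^ \<gamma>"
    note g = gamma[OF \<gamma>]
    have iN: "int N = int p ^ \<gamma>" by (simp add: N_def)
    have H: "residue_ind N H = Y'"
    proof
      fix x
      have "x mod m \<in> Y \<longleftrightarrow> x mod int N \<in> H"
        using m1 g(1) by (simp add: YH psi_def iN mod_mod_cancel)
      thus "residue_ind N H x = Y' x" by (simp add: residue_ind_def Y'_def m_def)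
    qed
    have "\<forall>x. residue_ind N H x + residue_ind N H (- x) = (if int N dvd x then 2 else 1)"
      using ms g(4) HN by (subst mset_symmetrization_iff[symmetric]) (simp_all add: N_def)
    hence W: "Y' x + Y' (- x) = (if int p ^ \<gamma> dvd x then 2 else 1)" for x
      by (simp add: H iN)
    have pN: "is_period (int p ^ \<gamma>) Y'"
      using is_period_residue_ind[of N H] by (simp add: H iN)
    \<comment> \<open>At a multiple of \<open>p ^ \<gamma>\<close> the two indicator values sum to
      2, so both are 1. The removed subgroup therefore lies in \<open>Y\<close> and equals
      \<open>Y - X\<close>.\<close>
    have mult_Y: "x \<in> Y" if "x \<in> {0..<m}" "int p ^ \<gamma> dvd x" for x
      using memY[OF that(1)] W[of x] that(2) Y01[of x] Y01[of "- x"] by auto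
    have diff: "Y - X = {0} \<or> Y - X = {z \<in> {0..<m}. int p ^ \<gamma> dvd z}"
      using XY unfolding g(5) using assms(6) mult_Y by blast
    have sub: "X \<subseteq> Y" using XY by blast
    have E_iff: "E x = (if x mod m \<in> Y - X then 1 else 0)" for x
      using sub by (auto simp: E_def X'_def Y'_def residue_ind_def m_def)
    have E: "E = dvd_ind m \<or> E = dvd_ind (int p ^ \<gamma>)"
      using diff
    proof
      assume d: "Y - X = {0}"
      have "E x = dvd_ind m x" for x unfolding E_iff d by (simp add: mod_eq_0_iff_dvd)
      thus ?thesis by blast
    next
      assume d: "Y - X = {z \<in> {0..<m}. int p ^ \<gamma> dvd z}"
      have "E x = dvd_ind (int p ^ \<gamma>) x" for x
        unfolding E_iff d using m1 g(1) by (simp add: dvd_mod_iff)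
      thus ?thesis by blast
    qed
    have XE: "X' = (\<lambda>x. Y' x - E x)" by (auto simp: E_def)
    have m0: "m > 0" using m1 by simp
    obtain t l where tl: "0 \<le> l" "0 < t" "t < sum X' {0..<m} + sum Y' {0..<m}"
      "\<forall>x. cconv m X' X' x + cconv m Y' (\<lambda>x. Y' (- x)) x =
        t * dvd_ind m x + l * X' x + sum Y' {0..<m} * (1 - dvd_ind m x - X' x)"
      "\<forall>x. cconv m X' Y' x + cconv m Y' (\<lambda>x. X' (- x)) x = l * Y' x + sum Y' {0..<m} * (1 - Y' x)"
      using classification_imp_dihedral_equations[OF g(2,3,1) m0 pN W XE E refl] by blast
    have "sum Y' {0..<m} \<ge> 0"
      by (rule sum_nonneg) (simp add: Y'_def residue_ind_def)
    hence "dsrg (Dih n X Y) (2 * n) (nat (sum X' {0..<m} + sum Y' {0..<m}))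
        (nat (sum Y' {0..<m})) (nat l) (nat t)"
      unfolding dsrg_iff using tl by simp
    hence "is_dsrg (Dih n X Y)" unfolding is_dsrg_def by blast
    moreover have "X \<subset> Y" using sub X assms(6) by auto
    moreover have "\<exists>\<O>. \<O> \<subseteq> unit_orbits m \<and> Y - X = \<Union>\<O>"
    proof (subst Union_unit_orbits_iff[OF m1])
      show "Y - X \<subseteq> {0..<m}" using Y by (auto simp: m_def)
      \<comment> \<open>\<open>Y - X\<close> is a subgroup in either case, hence stable under
        multiplication by any integer.\<close>
      show "\<forall>z\<in>Y - X. \<forall>u. coprime u m \<longrightarrow> u * z mod m \<in> Y - X"
        using diff m1 g(1) by (elim disjE) (auto simp: dvd_mod_iff)
    qed
    ultimately show ?L by (simp add: n_def m)
  qed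
qed

end
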